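(* Let $\mathfrak g=\mathfrak{sl}_2$, $\theta=\mathrm{id}$, and $\mathcal L^{\mathrm{tw}}$ the associated twisted loop algebra of the second kind. For each $\phi \in (\mathcal{L}^{\mathrm{tw},0})^*$, the following are equivalent: (1) $\dim V(\phi) < \infty$. (2) There exist $n \in \mathbb{Z}_{\geq 0}$ and $\alpha_1,\dots,\alpha_n \in \mathbb{C}^\times$ such that $$\phi(w_a) = \sum_{i=1}^n (\alpha_i+\alpha_i^{-1})^a \quad \text{for each } a \geq 0.$$
   Context: Let $e,f,h$ be the Chevalley basis of $\mathfrak{sl}_2$ over $\mathbb C$. Let $\mathcal L=\mathbb C[t,t^{-1}]\otimes\mathfrak{sl}_2$ be the loop algebra with $[P\otimes x,Q\otimes y]=PQ\otimes[x,y]$, let $\theta$ act by $\theta(t^m\otimes x)=t^{-m}\otimes x$, and let $\mathcal L^{\mathrm{tw}}=\{\mathfrak x\in\mathcal L\mid\theta(\mathfrak x)=\mathfrak x\}$. With $t_+=t+t^{-1}$ set, for $a\in\mathbb Z_{\ge0}$, $x_a=t_+^a\otimes e$, $y_a=t_+^a\otimes f$, $w_a=t_+^a\otimes h$; these form a basis of $\mathcal L^{\mathrm{tw}}$. Let $\mathcal L^{\mathrm{tw},+},\mathcal L^{\mathrm{tw},0}$ be the spans of the $x_a$, respectively the $w_a$. For $\phi\in(\mathcal L^{\mathrm{tw},0})^*$ (linear dual), $V(\phi)$ denotes the unique simple quotient of the universal highest weight module of highest weight $\phi$, i.e. the unique simple $\mathcal L^{\mathrm{tw}}$-module generated by a nonzero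 vector $v_\phi$ with $\mathcal L^{\mathrm{tw},+}v_\phi=0$ and $wv_\phi=\phi(w)v_\phi$ for all $w\in\mathcal L^{\mathrm{tw},0}$. Convention: $z^0=1$ for all $z\in\mathbb C$. *)

theory Defs
  imports
    "HOL-Analysis.Analysis"
    "HOL-Library.Poly_Mapping"
    "HOL-Library.Function_Algebras"
begin

section \<open>The loop algebra of sl2 and its twisted subalgebra\<close>

type_synonym laurent = "int \<Rightarrow>\<^sub>0 complex"

abbreviation lconst :: "complex \<Rightarrow> laurent" where
  "lconst c \<equiv> Poly_Mapping.single 0 c"

abbreviation t_pow :: "int \<Rightarrow> laurent" where
  "t_pow m \<equiv> Poly_Mapping.single m 1"

definition sl2 :: "(complex^2^2) set" where
  "sl2 = {A. trace A = 0}"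

definition sl2_e :: "complex^2^2" where
  "sl2_e = vector [vector [0, 1], vector [0, 0]]"

definition sl2_f :: "complex^2^2" where
  "sl2_f = vector [vector [0, 0], vector [1, 0]]"

definition sl2_h :: "complex^2^2" where
  "sl2_h = vector [vector [1, 0], vector [0, -1]]"

text \<open>
  The tensor product of the Laurent polynomial ring with sl2 is identified with the
  trace-zero 2 by 2 matrices over the Laurent polynomial ring (see \<open>loop_algebra_eq_span\<close>);
  under this identification the bracket of the loop algebra is the commutator
  (see \<open>bracket_tensor\<close>).
\<close>

type_synonym loop = "laurent^2^2"

definition tensor :: "laurent \<Rightarrow> complex^2^2 \<Rightarrow> loop" where
  "tensor P A = (\<chi> i j. P * lconst (A $ i $ j))"

definition loop_scale :: "complex \<Rightarrow> loop \<Rightarrow> loop" where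
  "loop_scale c X = (\<chi> i j. lconst c * X $ i $ j)"

definition bracket :: "'a::ring_1^'n^'n \<Rightarrow> 'a^'n^'n \<Rightarrow> 'a^'n^'n" where
  "bracket X Y = X ** Y - Y ** X"

definition loop_algebra :: "loop set" where
  "loop_algebra = {X. trace X = 0}"

definition theta :: "loop \<Rightarrow> loop" where
  "theta X = (\<chi> i j. Poly_Mapping.map_key uminus (X $ i $ j))"

definition Ltw :: "loop set" where
  "Ltw = {X \<in> loop_algebra. theta X = X}"

definition t_plus :: laurent where
  "t_plus = t_pow 1 + t_pow (-1)"

definition x_tw :: "nat \<Rightarrow> loop" where
  "x_tw a = tensor (t_plus ^ a) sl2_e"

definition y_tw :: "nat \<Rightarrow> loop" where
  "y_tw a = tensor (t_plus ^ a) sl2_f"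

definition w_tw :: "nat \<Rightarrow> loop" where
  "w_tw a = tensor (t_plus ^ a) sl2_h"

lemma lconst_mult: "lconst (a * b) = lconst a * lconst b"
  by (simp add: mult_single)

lemma lconst_add: "lconst (a + b) = lconst a + lconst b"
  by (simp add: single_add)

lemma lconst_uminus: "lconst (- a) = - lconst a"
  by (simp add: single_uminus)

lemma lconst_1: "lconst 1 = 1"
  by simp

interpretation loop: vector_space loop_scale
  by unfold_locales
    (auto simp: loop_scale_def vec_eq_iff lconst_mult lconst_add algebra_simps)

definition Ltw_plus :: "loop set" where
  "Ltw_plus = loop.span (range x_tw)"

definition Ltw_zero :: "loop set" where
  "Ltw_zero = loop.span (range w_tw)"

text \<open>
  Linear functionals on the subspace \<^term>\<open>Ltw_zero\<close>, given by total functions of which only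
  the values on that subspace matter.
\<close>

definition Ltw_zero_dual :: "(loop \<Rightarrow> complex) set" where
  "Ltw_zero_dual = {\<phi>.
     (\<forall>X\<in>Ltw_zero. \<forall>Y\<in>Ltw_zero. \<phi> (X + Y) = \<phi> X + \<phi> Y) \<and>
     (\<forall>c. \<forall>X\<in>Ltw_zero. \<phi> (loop_scale c X) = c * \<phi> X)}"


section \<open>Modules over the twisted loop algebra\<close>

text \<open>
  A module is a subspace \<open>V\<close> of an arbitrary complex vector space together with an action of
  \<^term>\<open>Ltw\<close> on \<open>V\<close>; values of \<open>act\<close> outside \<open>Ltw \<times> V\<close> are irrelevant.
\<close>

locale tw_module = vector_space scl
  for scl :: "complex \<Rightarrow> 'v::ab_group_add \<Rightarrow> 'v" +
  fixes V :: "'v set" and act :: "loop \<Rightarrow> 'v \<Rightarrow> 'v"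
  assumes V_subspace: "subspace V"
    and act_closed: "X \<in> Ltw \<Longrightarrow> v \<in> V \<Longrightarrow> act X v \<in> V"
    and act_add: "X \<in> Ltw \<Longrightarrow> v \<in> V \<Longrightarrow> v' \<in> V \<Longrightarrow> act X (v + v') = act X v + act X v'"
    and act_scale: "X \<in> Ltw \<Longrightarrow> v \<in> V \<Longrightarrow> act X (scl c v) = scl c (act X v)"
    and add_act: "X \<in> Ltw \<Longrightarrow> Y \<in> Ltw \<Longrightarrow> v \<in> V \<Longrightarrow> act (X + Y) v = act X v + act Y v"
    and scale_act: "X \<in> Ltw \<Longrightarrow> v \<in> V \<Longrightarrow> act (loop_scale c X) v = scl c (act X v)"
    and bracket_act: "X \<in> Ltw \<Longrightarrow> Y \<in> Ltw \<Longrightarrow> v \<in> V \<Longrightarrow>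
      act (bracket X Y) v = act X (act Y v) - act Y (act X v)"
begin

definition submodule :: "'v set \<Rightarrow> bool" where
  "submodule W \<longleftrightarrow> W \<subseteq> V \<and> subspace W \<and> (\<forall>X\<in>Ltw. \<forall>w\<in>W. act X w \<in> W)"

definition simple_module :: bool where
  "simple_module \<longleftrightarrow> V \<noteq> {0} \<and> (\<forall>W. submodule W \<longrightarrow> W = {0} \<or> W = V)"

definition generated_by :: "'v \<Rightarrow> bool" where
  "generated_by v \<longleftrightarrow> v \<in> V \<and> (\<forall>W. submodule W \<and> v \<in> W \<longrightarrow> W = V)"

end

text \<open>
  \<open>V\<close> is (a model of) the simple module \<open>V(\<phi>)\<close>, with highest weight vector \<open>v\<close>. That such a
  module exists for every \<open>\<phi>\<close> is \<open>simple_highest_weight_module_exists\<close> below.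
\<close>

locale simple_highest_weight_module = tw_module scl V act
  for scl :: "complex \<Rightarrow> 'v::ab_group_add \<Rightarrow> 'v" and V act +
  fixes \<phi> :: "loop \<Rightarrow> complex" and v :: 'v
  assumes simple: simple_module
    and v_nonzero: "v \<noteq> 0"
    and v_generates: "generated_by v"
    and v_plus: "X \<in> Ltw_plus \<Longrightarrow> act X v = 0"
    and v_weight: "X \<in> Ltw_zero \<Longrightarrow> act X v = scl (\<phi> X) v"

definition finite_dimensional ::
    "(complex \<Rightarrow> 'v::ab_group_add \<Rightarrow> 'v) \<Rightarrow> 'v set \<Rightarrow> bool" where
  "finite_dimensional scl V \<longleftrightarrow> (\<exists>B. finite B \<and> B \<subseteq> V \<and> module.span scl B = V)"


section \<open>Agreement with the tensor product description\<close>

lemma tensor_nth [simp]: "tensor P A $ i $ j = P * lconst (A $ i $ j)"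
  by (simp add: tensor_def)

lemma loop_scale_nth [simp]: "loop_scale c X $ i $ j = lconst c * X $ i $ j"
  by (simp add: loop_scale_def)

lemma sl2_efh_nth [simp]:
  "sl2_e $ 1 $ 1 = 0" "sl2_e $ 1 $ 2 = 1" "sl2_e $ 2 $ 1 = 0" "sl2_e $ 2 $ 2 = 0"
  "sl2_f $ 1 $ 1 = 0" "sl2_f $ 1 $ 2 = 0" "sl2_f $ 2 $ 1 = 1" "sl2_f $ 2 $ 2 = 0"
  "sl2_h $ 1 $ 1 = 1" "sl2_h $ 1 $ 2 = 0" "sl2_h $ 2 $ 1 = 0" "sl2_h $ 2 $ 2 = -1"
  by (simp_all add: sl2_e_def sl2_f_def sl2_h_def)

lemma sl2_efh: "sl2_e \<in> sl2" "sl2_f \<in> sl2" "sl2_h \<in> sl2"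
  by (simp_all add: sl2_def trace_def sum_2)

lemma sl2_brackets:
  "bracket sl2_e sl2_f = sl2_h"
  "bracket sl2_h sl2_e = 2 *\<^sub>R sl2_e"
  "bracket sl2_h sl2_f = - 2 *\<^sub>R sl2_f"
  by (simp_all add: bracket_def vec_eq_iff forall_2 matrix_matrix_mult_def sum_2
      scaleR_conv_of_real)

lemma bracket_tensor: "bracket (tensor P A) (tensor Q B) = tensor (P * Q) (bracket A B)"
  by (simp add: bracket_def vec_eq_iff forall_2 matrix_matrix_mult_def sum_2 lconst_add
      lconst_mult single_diff algebra_simps)

lemma theta_nth [simp]: "theta X $ i $ j = Poly_Mapping.map_key uminus (X $ i $ j)"
  by (simp add: theta_def)

lemma map_key_uminus_single:
  "Poly_Mapping.map_key uminus (Poly_Mapping.single m c) = Poly_Mapping.single (- m :: int) c"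
  using map_key_single[of "uminus :: int \<Rightarrow> int" "- m" c] by simp

lemma theta_tensor: "theta (tensor (t_pow m) A) = tensor (t_pow (- m)) A"
  by (simp add: vec_eq_iff mult_single map_key_uminus_single)

lemma loop_algebra_iff: "X \<in> loop_algebra \<longleftrightarrow> X $ 2 $ 2 = - X $ 1 $ 1"
  by (auto simp: loop_algebra_def trace_def sum_2 eq_neg_iff_add_eq_0 add.commute)

lemma tensor_decomposition:
  assumes "X \<in> loop_algebra"
  shows "X = tensor (X $ 1 $ 1) sl2_h + tensor (X $ 1 $ 2) sl2_e + tensor (X $ 2 $ 1) sl2_f"
  using assms by (simp add: loop_algebra_iff vec_eq_iff forall_2 lconst_uminus)

lemma loop_algebra_eq_span: "loop_algebra = loop.span {tensor P A |P A. A \<in> sl2}"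
proof
  show "loop_algebra \<subseteq> loop.span {tensor P A |P A. A \<in> sl2}"
  proof
    fix X assume "X \<in> loop_algebra"
    then show "X \<in> loop.span {tensor P A |P A. A \<in> sl2}"
      by (subst tensor_decomposition, assumption, intro loop.span_add; intro loop.span_base)
        (use sl2_efh in blast)+
  qed
  have "loop.subspace loop_algebra"
    by (auto simp: loop.subspace_def loop_algebra_iff)
  moreover have "{tensor P A |P A. A \<in> sl2} \<subseteq> loop_algebra"
    by (auto simp: loop_algebra_iff sl2_def trace_def sum_2 eq_neg_iff_add_eq_0 add.commute
        simp flip: distrib_left single_add)
  ultimately show "loop.span {tensor P A |P A. A \<in> sl2} \<subseteq> loop_algebra"
    by (rule loop.span_minimal[rotated])
qed

section \<open>Existence of the simple highest weight module\<close>

text \<open>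
  The simple module is realised inside the dual of the universal highest weight module: a
  function \<open>\<psi>\<close> on lists \<open>[P\<^sub>1, \<dots>, P\<^sub>k]\<close> of invariant Laurent polynomials stands for the
  functional with value \<open>\<psi> [P\<^sub>1, \<dots>, P\<^sub>k]\<close> on
  \<open>(P\<^sub>k \<otimes> f) \<cdots> (P\<^sub>1 \<otimes> f) v\<close>, and \<^term>\<open>Ltw\<close> acts through the
  anti-involution exchanging \<open>e\<close> and \<open>f\<close>. The submodule generated by the functional dual to
  the highest weight vector is simple.
\<close>

abbreviation linv :: "laurent \<Rightarrow> laurent" where
  "linv P \<equiv> Poly_Mapping.map_key uminus P"

lemma linv_add: "linv (P + Q) = linv P + linv Q"
  by (rule map_key_plus) simp

lemma linv_sum: "linv (sum g I) = (\<Sum>i\<in>I. linv (g i))"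
  by (induction I rule: infinite_finite_induct) (simp_all add: linv_add)

lemma laurent_expansion:
  "(\<Sum>k\<in>Poly_Mapping.keys P. Poly_Mapping.single k (Poly_Mapping.lookup P k)) = (P :: laurent)"
proof (rule poly_mapping_eqI)
  fix k
  have "(\<Sum>j\<in>Poly_Mapping.keys P. Poly_Mapping.lookup P j when j = k) = Poly_Mapping.lookup P k"
    by (cases "k \<in> Poly_Mapping.keys P")
      (auto simp: when_def in_keys_iff intro!: sum.neutral)
  then show "Poly_Mapping.lookup (\<Sum>k\<in>Poly_Mapping.keys P.
      Poly_Mapping.single k (Poly_Mapping.lookup P k)) k = Poly_Mapping.lookup P k"
    by (simp add: lookup_sum lookup_single)
qed

lemma linv_mult: "linv (P * Q) = linv P * linv Q"
proof -
  let ?s = "\<lambda>P k. Poly_Mapping.single k (Poly_Mapping.lookup P k) :: laurent"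
  have "linv ((\<Sum>k\<in>Poly_Mapping.keys P. ?s P k) * (\<Sum>l\<in>Poly_Mapping.keys Q. ?s Q l)) =
      linv (\<Sum>k\<in>Poly_Mapping.keys P. ?s P k) * linv (\<Sum>l\<in>Poly_Mapping.keys Q. ?s Q l)"
    by (simp add: sum_product linv_sum mult_single map_key_uminus_single)
  then show ?thesis
    by (simp only: laurent_expansion)
qed

lemma linv_const: "linv (lconst c) = lconst c"
  by (simp add: map_key_uminus_single)

lemma linv_uminus: "linv (- P) = - linv P"
  using linv_mult[of "lconst (-1)" P] linv_const[of "-1"]
  by (simp only: lconst_uminus) simp

lemma linv_diff: "linv (P - Q) = linv P - linv Q"
  using linv_add[of P "- Q"] by (simp add: linv_uminus)

typedef symlaurent = "{P :: laurent. linv P = P}"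
  by (rule exI[of _ 0]) simp

setup_lifting type_definition_symlaurent

instantiation symlaurent :: comm_ring
begin

lift_definition zero_symlaurent :: symlaurent is 0 by simp
lift_definition plus_symlaurent :: "symlaurent \<Rightarrow> symlaurent \<Rightarrow> symlaurent" is "(+)"
  by (simp add: linv_add)
lift_definition minus_symlaurent :: "symlaurent \<Rightarrow> symlaurent \<Rightarrow> symlaurent" is "(-)"
  by (simp add: linv_diff)
lift_definition uminus_symlaurent :: "symlaurent \<Rightarrow> symlaurent" is uminus
  by (simp add: linv_uminus)
lift_definition times_symlaurent :: "symlaurent \<Rightarrow> symlaurent \<Rightarrow> symlaurent" is "(*)"
  by (simp add: linv_mult)

instance
  by standard (transfer; simp add: algebra_simps)+

end

lift_definition sscale :: "complex \<Rightarrow> symlaurent \<Rightarrow> symlaurent" is "\<lambda>c P. lconst c * P"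
  by (simp add: linv_mult linv_const)

lemma sscale_mult: "P * sscale c Q = sscale c (P * Q)" "sscale c P * Q = sscale c (P * Q)"
  by (transfer; simp add: algebra_simps)+

subsection \<open>Invariant Laurent polynomials are the polynomials in \<open>t + t\<^sup>-\<^sup>1\<close>\<close>

interpretation laurent: vector_space "\<lambda>c (P::laurent). lconst c * P"
  by unfold_locales (auto simp: lconst_mult lconst_add algebra_simps)

abbreviation tp_span :: "laurent set" where
  "tp_span \<equiv> laurent.span (range (\<lambda>a. t_plus ^ a))"

lemma tp_span_mult: "P \<in> tp_span \<Longrightarrow> t_plus * P \<in> tp_span"
proof (induction rule: laurent.span_induct_alt)
  case base
  then show ?case by (simp add: laurent.span_zero)
next
  case (step c x y)
  then obtain a where "x = t_plus ^ a" by blast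
  then have "t_plus * x \<in> tp_span"
    by (metis laurent.span_base power_Suc rangeI)
  then have "lconst c * (t_plus * x) + t_plus * y \<in> tp_span"
    using step by (intro laurent.span_add laurent.span_scale)
  then show ?case by (simp add: algebra_simps)
qed

lemma t_pow_sym: "t_pow (int m) + t_pow (- int m) \<in> tp_span"
proof (induction m rule: less_induct)
  case (less m)
  have base: "1 \<in> tp_span" "t_plus \<in> tp_span"
    by (rule laurent.span_base, rule range_eqI[of _ _ 0], simp)
      (rule laurent.span_base, rule range_eqI[of _ _ 1], simp)
  consider "m = 0" | "m = 1" | k where "m = Suc (Suc k)"
    by (cases m; cases "m - 1") auto
  then show ?case
  proof cases
    case 1
    then show ?thesis using base laurent.span_add[of 1 _ 1] by simp
  next
    case 2
    then show ?thesis using base by (simp add: t_plus_def)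
  next
    case 3
    have "t_pow (int m) + t_pow (- int m) =
        t_plus * (t_pow (int (Suc k)) + t_pow (- int (Suc k))) - (t_pow (int k) + t_pow (- int k))"
      by (simp add: 3 t_plus_def algebra_simps mult_single)
        (intro arg_cong2[of _ _ _ _ Poly_Mapping.single]; simp)
    then show ?thesis
      using less[of "Suc k"] less[of k] 3 by (simp only:) (intro laurent.span_diff tp_span_mult; simp)
  qed
qed

lemma symmetric_in_tp_span:
  assumes "linv P = P"
  shows "P \<in> tp_span"
proof -
  let ?c = "\<lambda>k. Poly_Mapping.lookup P k"
  have single: "Poly_Mapping.single k c = lconst c * t_pow k" for k and c :: complex
    by (simp add: mult_single)
  have *: "t_pow k + t_pow (- k) \<in> tp_span" for k
    using t_pow_sym[of "nat \<bar>k\<bar>"] by (cases "k \<ge> 0") (auto simp: add.commute)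
  have half: "lconst (1/2) + lconst (1/2) = (1 :: laurent)"
    by (simp flip: single_add)
  have "P = (lconst (1/2) + lconst (1/2)) * P"
    by (simp add: half)
  also have "\<dots> = lconst (1/2) * (P + linv P)"
    by (simp add: assms algebra_simps)
  also have "P + linv P = (\<Sum>k\<in>Poly_Mapping.keys P. Poly_Mapping.single k (?c k)) +
      linv (\<Sum>k\<in>Poly_Mapping.keys P. Poly_Mapping.single k (?c k))"
    by (simp only: laurent_expansion)
  also have "\<dots> = (\<Sum>k\<in>Poly_Mapping.keys P. lconst (?c k) * (t_pow k + t_pow (- k)))"
    by (simp add: linv_sum map_key_uminus_single mult_single distrib_left sum.distrib)
  finally have "P = lconst (1/2) *
      (\<Sum>k\<in>Poly_Mapping.keys P. lconst (?c k) * (t_pow k + t_pow (- k)))" .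
  also have "\<dots> \<in> tp_span"
    by (intro laurent.span_scale laurent.span_sum *)
  finally show ?thesis .
qed

lemma linv_t_plus_power: "linv (t_plus ^ a) = t_plus ^ a"
  by (induction a)
    (simp_all add: linv_mult linv_const[of 1, simplified] t_plus_def linv_add
      map_key_uminus_single add.commute)

lemma linear_tensor_span:
  assumes "P \<in> tp_span"
  shows "tensor P A \<in> loop.span (range (\<lambda>a. tensor (t_plus ^ a) A))"
  using assms
proof (induction rule: laurent.span_induct_alt)
  case base
  have "tensor 0 A = 0" by (simp add: vec_eq_iff)
  then show ?case by (simp add: loop.span_zero)
next
  case (step c x y)
  then obtain a where "x = t_plus ^ a" by blast
  then have "loop_scale c (tensor x A) + tensor y A \<in> loop.span (range (\<lambda>a. tensor (t_plus ^ a) A))"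
    using step by (intro loop.span_add loop.span_scale) (auto intro: loop.span_base)
  moreover have "tensor (lconst c * x + y) A = loop_scale c (tensor x A) + tensor y A"
    by (simp add: vec_eq_iff algebra_simps)
  ultimately show ?case by simp
qed

lemma span_tensor:
  "loop.span (range (\<lambda>a. tensor (t_plus ^ a) A)) = {tensor P A |P. linv P = P}"
proof
  show "{tensor P A |P. linv P = P} \<subseteq> loop.span (range (\<lambda>a. tensor (t_plus ^ a) A))"
    using linear_tensor_span symmetric_in_tp_span by blast
  have "loop.subspace {tensor P A |P. linv P = P}"
    unfolding loop.subspace_def
  proof (intro conjI ballI allI)
    show "0 \<in> {tensor P A |P. linv P = P}"
      by (rule CollectI, rule exI[of _ 0]) (simp add: vec_eq_iff)
  next
    fix X Y assume "X \<in> {tensor P A |P. linv P = P}" "Y \<in> {tensor P A |P. linv P = P}"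
    then obtain P Q where "X = tensor P A" "linv P = P" "Y = tensor Q A" "linv Q = Q" by blast
    then show "X + Y \<in> {tensor P A |P. linv P = P}"
      by (intro CollectI exI[of _ "P + Q"]) (simp add: vec_eq_iff linv_add algebra_simps)
  next
    fix c X assume "X \<in> {tensor P A |P. linv P = P}"
    then obtain P where "X = tensor P A" "linv P = P" by blast
    then show "loop_scale c X \<in> {tensor P A |P. linv P = P}"
      by (intro CollectI exI[of _ "lconst c * P"])
        (simp add: vec_eq_iff linv_mult linv_const algebra_simps)
  qed
  then show "loop.span (range (\<lambda>a. tensor (t_plus ^ a) A)) \<subseteq> {tensor P A |P. linv P = P}"
    by (intro loop.span_minimal) (use linv_t_plus_power in blast)+
qed

lemma Ltw_plus_eq: "Ltw_plus = {tensor P sl2_e |P. linv P = P}"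
  unfolding Ltw_plus_def x_tw_def by (rule span_tensor)

lemma Ltw_zero_eq: "Ltw_zero = {tensor P sl2_h |P. linv P = P}"
  unfolding Ltw_zero_def w_tw_def by (rule span_tensor)

lemma Ltw_iff: "X \<in> Ltw \<longleftrightarrow> X \<in> loop_algebra \<and> (\<forall>i j. linv (X $ i $ j) = X $ i $ j)"
  by (simp add: Ltw_def vec_eq_iff)

lemma Ltw_eq_span: "Ltw = loop.span (range x_tw \<union> range y_tw \<union> range w_tw)"
proof
  show "Ltw \<subseteq> loop.span (range x_tw \<union> range y_tw \<union> range w_tw)"
  proof
    fix X assume X: "X \<in> Ltw"
    have "tensor (X $ i $ j) A \<in> loop.span (range (\<lambda>a. tensor (t_plus ^ a) A))" for i j A
      using X by (auto simp: Ltw_iff span_tensor)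
    then have "tensor (X $ 1 $ 1) sl2_h + tensor (X $ 1 $ 2) sl2_e + tensor (X $ 2 $ 1) sl2_f
        \<in> loop.span (range x_tw \<union> range y_tw \<union> range w_tw)"
      unfolding x_tw_def y_tw_def w_tw_def
      by (intro loop.span_add; rule subsetD[OF loop.span_mono, rotated]) auto
    then show "X \<in> loop.span (range x_tw \<union> range y_tw \<union> range w_tw)"
      using tensor_decomposition[of X] X by (simp add: Ltw_iff)
  qed
  have "loop.subspace Ltw"
    by (auto simp: loop.subspace_def Ltw_iff loop_algebra_iff linv_add linv_mult linv_const)
  moreover have "range x_tw \<union> range y_tw \<union> range w_tw \<subseteq> Ltw"
    by (auto simp: x_tw_def y_tw_def w_tw_def Ltw_iff loop_algebra_iff forall_2
        linv_mult linv_const linv_t_plus_power lconst_uminus)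
  ultimately show "loop.span (range x_tw \<union> range y_tw \<union> range w_tw) \<subseteq> Ltw"
    by (rule loop.span_minimal[rotated])
qed

subsection \<open>The operators dual to the action on the universal highest weight module\<close>

type_synonym functional = "symlaurent list \<Rightarrow> complex"

definition fscale :: "complex \<Rightarrow> functional \<Rightarrow> functional" where
  "fscale c \<psi> = (\<lambda>l. c * \<psi> l)"

lemma fscale_apply [simp]: "fscale c \<psi> l = c * \<psi> l"
  by (simp add: fscale_def)

interpretation functional: vector_space fscale
  by unfold_locales (auto simp: fun_eq_iff algebra_simps)

definition Xop :: "symlaurent \<Rightarrow> functional \<Rightarrow> functional" where
  "Xop P \<psi> = (\<lambda>l. \<psi> (P # l))"

fun Wop :: "(symlaurent \<Rightarrow> complex) \<Rightarrow> symlaurent \<Rightarrow> functional \<Rightarrow> functional" where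
  "Wop p P \<psi> [] = p P * \<psi> []"
| "Wop p P \<psi> (Q # l) = Wop p P (Xop Q \<psi>) l - 2 * \<psi> (P * Q # l)"

fun Yop :: "(symlaurent \<Rightarrow> complex) \<Rightarrow> symlaurent \<Rightarrow> functional \<Rightarrow> functional" where
  "Yop p P \<psi> [] = 0"
| "Yop p P \<psi> (Q # l) = Yop p P (Xop Q \<psi>) l + Wop p (P * Q) \<psi> l"

lemma Xop_apply [simp]: "Xop P \<psi> l = \<psi> (P # l)"
  by (simp add: Xop_def)

lemma Xop_lin: "Xop P (\<psi> + \<eta>) = Xop P \<psi> + Xop P \<eta>" "Xop P (fscale c \<psi>) = fscale c (Xop P \<psi>)"
  by (auto simp: fun_eq_iff)

lemma Wop_add: "Wop p P (\<psi> + \<eta>) = Wop p P \<psi> + Wop p P \<eta>"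
proof
  show "Wop p P (\<psi> + \<eta>) l = (Wop p P \<psi> + Wop p P \<eta>) l" for l
    by (induction l arbitrary: \<psi> \<eta>) (simp_all add: Xop_lin algebra_simps)
qed

lemma Wop_scale: "Wop p P (fscale c \<psi>) = fscale c (Wop p P \<psi>)"
proof
  show "Wop p P (fscale c \<psi>) l = fscale c (Wop p P \<psi>) l" for l
    by (induction l arbitrary: \<psi>) (simp_all add: Xop_lin algebra_simps)
qed

lemma Yop_add: "Yop p P (\<psi> + \<eta>) = Yop p P \<psi> + Yop p P \<eta>"
proof
  show "Yop p P (\<psi> + \<eta>) l = (Yop p P \<psi> + Yop p P \<eta>) l" for l
    by (induction l arbitrary: \<psi> \<eta>) (simp_all add: Xop_lin Wop_add algebra_simps)
qed

lemma Yop_scale: "Yop p P (fscale c \<psi>) = fscale c (Yop p P \<psi>)"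
proof
  show "Yop p P (fscale c \<psi>) l = fscale c (Yop p P \<psi>) l" for l
    by (induction l arbitrary: \<psi>) (simp_all add: Xop_lin Wop_scale algebra_simps)
qed

lemma Wop_diff: "Wop p P (\<psi> - \<eta>) = Wop p P \<psi> - Wop p P \<eta>"
  using Wop_add[of p P "\<psi> - \<eta>" \<eta>] by simp

lemma Yop_diff: "Yop p P (\<psi> - \<eta>) = Yop p P \<psi> - Yop p P \<eta>"
  using Yop_add[of p P "\<psi> - \<eta>" \<eta>] by simp

lemma X_W: "Xop Q (Wop p P \<psi>) = Wop p P (Xop Q \<psi>) + fscale (-2) (Xop (P * Q) \<psi>)"
  by (auto simp: fun_eq_iff)

lemma X_Y: "Xop Q (Yop p P \<psi>) = Yop p P (Xop Q \<psi>) + Wop p (P * Q) \<psi>"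
  by (auto simp: fun_eq_iff)

lemma W_W: "Wop p P (Wop p R \<psi>) = Wop p R (Wop p P \<psi>)"
proof
  show "Wop p P (Wop p R \<psi>) l = Wop p R (Wop p P \<psi>) l" for l
    by (induction l arbitrary: \<psi>)
      (simp_all add: X_W Wop_diff Wop_scale algebra_simps)
qed

lemma W_Y: "Wop p P (Yop p R \<psi>) = Yop p R (Wop p P \<psi>) + fscale (-2) (Yop p (P * R) \<psi>)"
proof
  show "Wop p P (Yop p R \<psi>) l = (Yop p R (Wop p P \<psi>) + fscale (-2) (Yop p (P * R) \<psi>)) l" for l
    by (induction l arbitrary: \<psi>)
      (simp_all add: X_W X_Y Wop_add Yop_diff Yop_scale W_W[of p P] algebra_simps)
qed

lemma Y_Y: "Yop p P (Yop p R \<psi>) = Yop p R (Yop p P \<psi>)"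
proof
  show "Yop p P (Yop p R \<psi>) l = Yop p R (Yop p P \<psi>) l" for l
    by (induction l arbitrary: \<psi>)
      (simp_all add: X_Y Yop_add W_Y algebra_simps)
qed

definition multilinear :: "functional set" where
  "multilinear = {\<psi>.
     (\<forall>k P Q l. \<psi> (k @ (P + Q) # l) = \<psi> (k @ P # l) + \<psi> (k @ Q # l)) \<and>
     (\<forall>k c P l. \<psi> (k @ sscale c P # l) = c * \<psi> (k @ P # l)) \<and>
     (\<forall>k P Q l. \<psi> (k @ P # Q # l) = \<psi> (k @ Q # P # l))}"

lemma multilinearI:
  assumes "\<And>k P Q l. \<psi> (k @ (P + Q) # l) = \<psi> (k @ P # l) + \<psi> (k @ Q # l)"
    and "\<And>k c P l. \<psi> (k @ sscale c P # l) = c * \<psi> (k @ P # l)"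
    and "\<And>k P Q l. \<psi> (k @ P # Q # l) = \<psi> (k @ Q # P # l)"
  shows "\<psi> \<in> multilinear"
  using assms by (simp add: multilinear_def)

lemma multilinearD:
  assumes "\<psi> \<in> multilinear"
  shows "\<psi> (k @ (P + Q) # l) = \<psi> (k @ P # l) + \<psi> (k @ Q # l)"
    and "\<psi> (k @ sscale c P # l) = c * \<psi> (k @ P # l)"
    and "\<psi> (k @ P # Q # l) = \<psi> (k @ Q # P # l)"
  using assms unfolding multilinear_def by blast+

lemma multilinearD0:
  assumes "\<psi> \<in> multilinear"
  shows "\<psi> ((P + Q) # l) = \<psi> (P # l) + \<psi> (Q # l)"
    and "\<psi> (sscale c P # l) = c * \<psi> (P # l)"
    and "\<psi> (P # Q # l) = \<psi> (Q # P # l)"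
  using multilinearD[OF assms, of "[]"] by simp_all

lemma Xop_multilinear:
  assumes "\<psi> \<in> multilinear"
  shows "Xop P \<psi> \<in> multilinear"
  using multilinearD[OF assms, of "P # _"] by (intro multilinearI) simp_all

lemma Xop_lin_left:
  assumes "\<psi> \<in> multilinear"
  shows "Xop (P + Q) \<psi> = Xop P \<psi> + Xop Q \<psi>" "Xop (sscale c P) \<psi> = fscale c (Xop P \<psi>)"
    and "Xop P (Xop Q \<psi>) = Xop Q (Xop P \<psi>)"
  using multilinearD0[OF assms] by (auto simp: fun_eq_iff)

locale weight_functional =
  fixes p :: "symlaurent \<Rightarrow> complex"
  assumes p_add: "p (P + Q) = p P + p Q"
    and p_scale: "p (sscale c P) = c * p P"
begin

lemma Wop_lin_left:
  assumes "\<psi> \<in> multilinear"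
  shows "Wop p (P + Q) \<psi> = Wop p P \<psi> + Wop p Q \<psi>"
    and "Wop p (sscale c P) \<psi> = fscale c (Wop p P \<psi>)"
proof -
  have "Wop p (P + Q) \<psi> l = (Wop p P \<psi> + Wop p Q \<psi>) l \<and>
      Wop p (sscale c P) \<psi> l = fscale c (Wop p P \<psi>) l" for l
    using assms
    by (induction l arbitrary: \<psi>)
      (simp_all add: p_add p_scale Xop_multilinear multilinearD0 distrib_right sscale_mult
        algebra_simps)
  then show "Wop p (P + Q) \<psi> = Wop p P \<psi> + Wop p Q \<psi>"
    "Wop p (sscale c P) \<psi> = fscale c (Wop p P \<psi>)"
    by (simp_all add: fun_eq_iff)
qed

lemma Yop_lin_left:
  assumes "\<psi> \<in> multilinear"
  shows "Yop p (P + Q) \<psi> = Yop p P \<psi> + Yop p Q \<psi>"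
    and "Yop p (sscale c P) \<psi> = fscale c (Yop p P \<psi>)"
proof -
  have "Yop p (P + Q) \<psi> l = (Yop p P \<psi> + Yop p Q \<psi>) l \<and>
      Yop p (sscale c P) \<psi> l = fscale c (Yop p P \<psi>) l" for l
    using assms
    by (induction l arbitrary: \<psi>)
      (simp_all add: Xop_multilinear Wop_lin_left distrib_right sscale_mult algebra_simps)
  then show "Yop p (P + Q) \<psi> = Yop p P \<psi> + Yop p Q \<psi>"
    "Yop p (sscale c P) \<psi> = fscale c (Yop p P \<psi>)"
    by (simp_all add: fun_eq_iff)
qed

lemma Wop_multilinear:
  assumes "\<psi> \<in> multilinear"
  shows "Wop p P \<psi> \<in> multilinear"
proof (rule multilinearI)
  fix k A B l c
  show "Wop p P \<psi> (k @ (A + B) # l) = Wop p P \<psi> (k @ A # l) + Wop p P \<psi> (k @ B # l)"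
    using assms
  proof (induction k arbitrary: \<psi>)
    case Nil
    then show ?case
      by (simp add: Xop_lin_left Wop_add multilinearD0 distrib_left)
  next
    case (Cons Q k)
    have "\<psi> (P * Q # k @ (A + B) # l) = \<psi> (P * Q # k @ A # l) + \<psi> (P * Q # k @ B # l)"
      using multilinearD(1)[OF Cons.prems, of "P * Q # k"] by simp
    with Cons.IH[OF Xop_multilinear[OF Cons.prems, of Q]] show ?case
      by (simp del: Xop_apply)
  qed
  show "Wop p P \<psi> (k @ sscale c A # l) = c * Wop p P \<psi> (k @ A # l)"
    using assms
  proof (induction k arbitrary: \<psi>)
    case Nil
    then show ?case
      by (simp add: Xop_lin_left Wop_scale multilinearD0 sscale_mult algebra_simps)
  next
    case (Cons Q k)
    then show ?case
      using multilinearD(2)[OF Cons.prems, of "P * Q # k"]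
        Cons.IH[OF Xop_multilinear[OF Cons.prems, of Q]]
      by (simp add: algebra_simps del: Xop_apply)
  qed
  show "Wop p P \<psi> (k @ A # B # l) = Wop p P \<psi> (k @ B # A # l)"
    using assms
  proof (induction k arbitrary: \<psi>)
    case Nil
    then show ?case
      using multilinearD0(3)[OF Nil, of "P * A"] multilinearD0(3)[OF Nil, of "P * B"]
      by (simp add: Xop_lin_left(3)[of \<psi> A B])
  next
    case (Cons Q k)
    then show ?case
      using multilinearD(3)[OF Cons.prems, of "P * Q # k"]
        Cons.IH[OF Xop_multilinear[OF Cons.prems, of Q]]
      by (simp add: algebra_simps del: Xop_apply)
  qed
qed

lemma Yop_multilinear:
  assumes "\<psi> \<in> multilinear"
  shows "Yop p P \<psi> \<in> multilinear"
proof (rule multilinearI)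
  fix k A B l c
  show "Yop p P \<psi> (k @ (A + B) # l) = Yop p P \<psi> (k @ A # l) + Yop p P \<psi> (k @ B # l)"
    using assms
  proof (induction k arbitrary: \<psi>)
    case Nil
    then show ?case
      by (simp add: Xop_lin_left Yop_add Wop_lin_left distrib_left)
  next
    case (Cons Q k)
    from multilinearD(1)[OF Wop_multilinear[OF Cons.prems], of "P * Q" k]
      Cons.IH[OF Xop_multilinear[OF Cons.prems, of Q]]
    show ?case by (simp del: Xop_apply)
  qed
  show "Yop p P \<psi> (k @ sscale c A # l) = c * Yop p P \<psi> (k @ A # l)"
    using assms
  proof (induction k arbitrary: \<psi>)
    case Nil
    then show ?case
      by (simp add: Xop_lin_left Yop_scale Wop_lin_left sscale_mult algebra_simps)
  next
    case (Cons Q k)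
    then show ?case
      using multilinearD(2)[OF Wop_multilinear[OF Cons.prems], of "P * Q" k]
        Cons.IH[OF Xop_multilinear[OF Cons.prems, of Q]]
      by (simp add: algebra_simps del: Xop_apply)
  qed
  show "Yop p P \<psi> (k @ A # B # l) = Yop p P \<psi> (k @ B # A # l)"
    using assms
  proof (induction k arbitrary: \<psi>)
    case Nil
    then show ?case
      by (simp add: Xop_lin_left(3)[of \<psi> A B] mult.assoc mult.commute[of A B])
  next
    case (Cons Q k)
    then show ?case
      using multilinearD(3)[OF Wop_multilinear[OF Cons.prems], of "P * Q" k]
        Cons.IH[OF Xop_multilinear[OF Cons.prems, of Q]]
      by (simp add: algebra_simps del: Xop_apply)
  qed
qed

subsection \<open>The module and its simplicity\<close>

text \<open>Multilinear functionals vanishing on all sufficiently long lists.\<close>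

definition D :: "functional set" where
  "D = {\<psi> \<in> multilinear. \<exists>N. \<forall>l. length l > N \<longrightarrow> \<psi> l = 0}"

definition sym_entry :: "loop \<Rightarrow> 2 \<Rightarrow> 2 \<Rightarrow> symlaurent" where
  "sym_entry X i j = Abs_symlaurent (X $ i $ j)"

definition f_act :: "loop \<Rightarrow> functional \<Rightarrow> functional" where
  "f_act X \<psi> = Wop p (sym_entry X 1 1) \<psi> + Xop (sym_entry X 1 2) \<psi> + Yop p (sym_entry X 2 1) \<psi>"

lemma Wop_vanish: "\<forall>l. length l > N \<longrightarrow> \<psi> l = 0 \<Longrightarrow> length l > N \<Longrightarrow> Wop p P \<psi> l = 0"
proof (induction l arbitrary: \<psi> N)
  case (Cons Q l)
  have "Wop p P (Xop Q \<psi>) l = 0"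
  proof (cases N)
    case 0
    then have "Xop Q \<psi> = fscale 0 \<psi>" using Cons.prems by (auto simp: fun_eq_iff)
    then show ?thesis by (simp only: Wop_scale) simp
  next
    case (Suc M)
    then show ?thesis using Cons.prems by (intro Cons.IH[of M]) auto
  qed
  then show ?case using Cons.prems by simp
qed simp

lemma Yop_vanish: "\<forall>l. length l > N \<longrightarrow> \<psi> l = 0 \<Longrightarrow> length l > Suc N \<Longrightarrow> Yop p P \<psi> l = 0"
proof (induction l arbitrary: \<psi> N)
  case (Cons Q l)
  have "Yop p P (Xop Q \<psi>) l = 0"
  proof (cases N)
    case 0
    then have "Xop Q \<psi> = fscale 0 \<psi>" using Cons.prems by (auto simp: fun_eq_iff)
    then show ?thesis by (simp only: Yop_scale) simp
  next
    case (Suc M)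
    then show ?thesis using Cons.prems by (intro Cons.IH[of M]) auto
  qed
  then show ?case using Cons.prems Wop_vanish[of N \<psi> l] by simp
qed simp

lemma D_subspace: "functional.subspace D"
  unfolding functional.subspace_def
proof (intro conjI ballI allI)
  show "0 \<in> D" by (simp add: D_def multilinear_def)
next
  fix \<psi> \<eta> assume "\<psi> \<in> D" "\<eta> \<in> D"
  then obtain N M where *: "\<psi> \<in> multilinear" "\<eta> \<in> multilinear"
    "\<forall>l. length l > N \<longrightarrow> \<psi> l = 0" "\<forall>l. length l > M \<longrightarrow> \<eta> l = 0" by (auto simp: D_def)
  have "\<psi> + \<eta> \<in> multilinear"
    using multilinearD[OF *(1)] multilinearD[OF *(2)]
    by (intro multilinearI) (simp_all add: algebra_simps)
  then show "\<psi> + \<eta> \<in> D"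
    using * by (auto simp: D_def intro!: exI[of _ "max N M"])
next
  fix c \<psi> assume "\<psi> \<in> D"
  then have "\<psi> \<in> multilinear" by (simp add: D_def)
  then have "fscale c \<psi> \<in> multilinear"
    using multilinearD[of \<psi>] by (intro multilinearI) (simp_all add: algebra_simps)
  then show "fscale c \<psi> \<in> D"
    using \<open>\<psi> \<in> D\<close> by (auto simp: D_def)
qed

lemma D_ops:
  assumes "\<psi> \<in> D"
  shows "Xop P \<psi> \<in> D" "Wop p P \<psi> \<in> D" "Yop p P \<psi> \<in> D"
proof -
  obtain N where *: "\<psi> \<in> multilinear" "\<forall>l. length l > N \<longrightarrow> \<psi> l = 0"
    using assms by (auto simp: D_def)
  show "Xop P \<psi> \<in> D"
    using * by (auto simp: D_def Xop_multilinear intro!: exI[of _ N])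
  show "Wop p P \<psi> \<in> D"
    using * Wop_vanish[of N \<psi>] by (auto simp: D_def Wop_multilinear intro!: exI[of _ N])
  show "Yop p P \<psi> \<in> D"
    using * Yop_vanish[of N \<psi>] by (auto simp: D_def Yop_multilinear intro!: exI[of _ "Suc N"])
qed

lemma f_act_closed: "\<psi> \<in> D \<Longrightarrow> f_act X \<psi> \<in> D"
  unfolding f_act_def by (intro functional.subspace_add[OF D_subspace] D_ops)

lemma D_multilinear: "\<psi> \<in> D \<Longrightarrow> \<psi> \<in> multilinear"
  by (simp add: D_def)

lemma Rep_sym_entry: "X \<in> Ltw \<Longrightarrow> Rep_symlaurent (sym_entry X i j) = X $ i $ j"
  by (simp add: sym_entry_def Ltw_iff Abs_symlaurent_inverse)

lemma sym_entry_eqI: "Rep_symlaurent P = X $ i $ j \<Longrightarrow> sym_entry X i j = P"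
  by (metis sym_entry_def Rep_symlaurent_inverse)

lemma sym_entry_add:
  "X \<in> Ltw \<Longrightarrow> Y \<in> Ltw \<Longrightarrow> sym_entry (X + Y) i j = sym_entry X i j + sym_entry Y i j"
  by (rule sym_entry_eqI) (simp add: plus_symlaurent.rep_eq Rep_sym_entry)

lemma sym_entry_scale:
  "X \<in> Ltw \<Longrightarrow> sym_entry (loop_scale c X) i j = sscale c (sym_entry X i j)"
  by (rule sym_entry_eqI) (simp add: sscale.rep_eq Rep_sym_entry)

lemma sym_entry_bracket:
  assumes "X \<in> Ltw" "Y \<in> Ltw"
  shows "sym_entry (bracket X Y) 1 1 =
      sym_entry X 1 2 * sym_entry Y 2 1 + sscale (-1) (sym_entry Y 1 2 * sym_entry X 2 1)"
    and "sym_entry (bracket X Y) 1 2 =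
      sscale 2 (sym_entry X 1 1 * sym_entry Y 1 2) +
      sscale (-2) (sym_entry Y 1 1 * sym_entry X 1 2)"
    and "sym_entry (bracket X Y) 2 1 =
      sscale 2 (sym_entry X 2 1 * sym_entry Y 1 1) +
      sscale (-2) (sym_entry Y 2 1 * sym_entry X 1 1)"
proof -
  have two: "lconst 2 = (2 :: laurent)" "lconst (-2) = (-2 :: laurent)" "lconst (-1) = (-1 :: laurent)"
    by (simp_all only: lconst_uminus single_numeral single_one)
  have diag: "X $ 2 $ 2 = - X $ 1 $ 1" "Y $ 2 $ 2 = - Y $ 1 $ 1"
    using assms by (simp_all add: Ltw_iff loop_algebra_iff)
  note [simp] = plus_symlaurent.rep_eq times_symlaurent.rep_eq sscale.rep_eq Rep_sym_entry[OF assms(1)]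
    Rep_sym_entry[OF assms(2)] bracket_def matrix_matrix_mult_def sum_2 two diag
  show "sym_entry (bracket X Y) 1 1 =
      sym_entry X 1 2 * sym_entry Y 2 1 + sscale (-1) (sym_entry Y 1 2 * sym_entry X 2 1)"
    by (rule sym_entry_eqI) (simp add: algebra_simps)
  show "sym_entry (bracket X Y) 1 2 =
      sscale 2 (sym_entry X 1 1 * sym_entry Y 1 2) +
      sscale (-2) (sym_entry Y 1 1 * sym_entry X 1 2)"
    by (rule sym_entry_eqI) (simp add: algebra_simps)
  show "sym_entry (bracket X Y) 2 1 =
      sscale 2 (sym_entry X 2 1 * sym_entry Y 1 1) +
      sscale (-2) (sym_entry Y 2 1 * sym_entry X 1 1)"
    by (rule sym_entry_eqI) (simp add: algebra_simps)
qed

lemma f_act_bracket: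
  assumes "X \<in> Ltw" "Y \<in> Ltw" "\<psi> \<in> D"
  shows "f_act (bracket X Y) \<psi> = f_act X (f_act Y \<psi>) - f_act Y (f_act X \<psi>)"
proof -
  have m: "\<psi> \<in> multilinear" using assms by (simp add: D_def)
  show ?thesis
    unfolding f_act_def sym_entry_bracket[OF assms(1,2)]
    by (simp only: Wop_lin_left[OF m] Yop_lin_left[OF m] Xop_lin_left(1,2)[OF m] Xop_lin Wop_add
        Yop_add X_W X_Y W_Y)
      (simp add: W_W[of _ "sym_entry X 1 1"] Y_Y[of _ "sym_entry X 2 1"]
        Xop_lin_left(3)[OF m, of "sym_entry X 1 2"] fun_eq_iff algebra_simps)
qed

definition vac :: functional where
  "vac l = (if l = [] then 1 else 0)"

lemma vac_D: "vac \<in> D"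
  by (auto simp: D_def vac_def intro!: multilinearI)

lemma Xop_vac: "Xop P vac = 0"
  by (auto simp: vac_def fun_eq_iff)

lemma Wop_vac: "Wop p P vac = fscale (p P) vac"
proof
  fix l
  have zero: "Wop p P 0 = 0"
    using Wop_scale[of p P 0 0] by (simp add: fun_eq_iff zero_fun_def)
  show "Wop p P vac l = fscale (p P) vac l"
    by (cases l) (simp_all add: Xop_vac zero, simp_all add: vac_def)
qed

definition tw_closed :: "functional set \<Rightarrow> bool" where
  "tw_closed S \<longleftrightarrow> S \<subseteq> D \<and> functional.subspace S \<and> (\<forall>X\<in>Ltw. \<forall>\<psi>\<in>S. f_act X \<psi> \<in> S)"

definition Vmod :: "functional set" where
  "Vmod = \<Inter>{S. tw_closed S \<and> vac \<in> S}"

lemma D_closed: "tw_closed D"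
  by (simp add: tw_closed_def D_subspace f_act_closed)

lemma Vmod_subset: "tw_closed S \<Longrightarrow> vac \<in> S \<Longrightarrow> Vmod \<subseteq> S"
  by (auto simp: Vmod_def)

lemma vac_Vmod: "vac \<in> Vmod"
  by (simp add: Vmod_def)

lemma Vmod_closed: "tw_closed Vmod"
  unfolding tw_closed_def
proof (intro conjI ballI)
  show "Vmod \<subseteq> D" by (rule Vmod_subset[OF D_closed vac_D])
  show "functional.subspace Vmod"
    unfolding Vmod_def by (rule functional.subspace_Inter) (auto simp: tw_closed_def)
  show "f_act X \<psi> \<in> Vmod" if "X \<in> Ltw" "\<psi> \<in> Vmod" for X \<psi>
    using that by (auto simp: Vmod_def tw_closed_def)
qed

lemma f_act_tensor:
  assumes "linv P = P"
  shows "tensor P sl2_e \<in> Ltw" "tensor P sl2_h \<in> Ltw"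
    and "\<psi> \<in> D \<Longrightarrow> f_act (tensor P sl2_e) \<psi> = Xop (Abs_symlaurent P) \<psi>"
    and "\<psi> \<in> D \<Longrightarrow> f_act (tensor P sl2_h) \<psi> = Wop p (Abs_symlaurent P) \<psi>"
proof -
  show "tensor P sl2_e \<in> Ltw" "tensor P sl2_h \<in> Ltw"
    using assms by (simp_all add: Ltw_iff loop_algebra_iff forall_2 linv_uminus lconst_uminus)
  assume D: "\<psi> \<in> D"
  have "sscale 0 0 = 0" by transfer simp
  then have zero: "Wop p 0 \<psi> = 0" "Yop p 0 \<psi> = 0" "Xop 0 \<psi> = 0"
    using Wop_lin_left(2)[of \<psi> 0 0] Yop_lin_left(2)[of \<psi> 0 0] Xop_lin_left(2)[of \<psi> 0 0]
      D_multilinear[OF D] by (simp_all add: fun_eq_iff)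
  have abs0: "Abs_symlaurent 0 = 0" by (simp add: zero_symlaurent_def)
  show "f_act (tensor P sl2_e) \<psi> = Xop (Abs_symlaurent P) \<psi>"
    "f_act (tensor P sl2_h) \<psi> = Wop p (Abs_symlaurent P) \<psi>"
    by (simp_all add: f_act_def sym_entry_def abs0 zero)
qed

lemma vac_in_closed:
  assumes S: "tw_closed S" and "S \<noteq> {0}"
  shows "vac \<in> S"
proof -
  have sub: "functional.subspace S" using S by (simp add: tw_closed_def)
  have X: "Xop P \<psi> \<in> S" if "\<psi> \<in> S" for P \<psi>
  proof -
    have P: "linv (Rep_symlaurent P) = Rep_symlaurent P" using Rep_symlaurent by blast
    have "f_act (tensor (Rep_symlaurent P) sl2_e) \<psi> \<in> S"
      using S that f_act_tensor(1)[OF P] by (simp add: tw_closed_def)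
    then show ?thesis
      using f_act_tensor(3)[OF P] that S by (auto simp: tw_closed_def Rep_symlaurent_inverse)
  qed
  have shift: "(\<lambda>k. \<psi> (l @ k)) \<in> S" if "\<psi> \<in> S" for l \<psi>
    using that
  proof (induction l arbitrary: \<psi>)
    case (Cons P l)
    then show ?case using Cons.IH[OF X[OF Cons.prems, of P]] by simp
  qed simp
  obtain \<psi> where \<psi>: "\<psi> \<in> S" "\<psi> \<noteq> 0"
    using assms functional.subspace_0[OF sub] by blast
  then obtain N where N: "\<And>l. length l > N \<Longrightarrow> \<psi> l = 0"
    using S unfolding tw_closed_def D_def by blast
  obtain l0 where l0: "\<psi> l0 \<noteq> 0" using \<psi>(2) by (auto simp: fun_eq_iff)
  have bound: "\<forall>k. \<psi> k \<noteq> 0 \<longrightarrow> length k < Suc N" using N by (meson not_less_eq)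
  obtain l where l: "\<psi> l \<noteq> 0" and max: "\<And>k. \<psi> k \<noteq> 0 \<Longrightarrow> length k \<le> length l"
    using ex_has_greatest_nat[of "\<lambda>k. \<psi> k \<noteq> 0" l0 length "Suc N"] l0 bound by blast
  have "(\<lambda>k. \<psi> (l @ k)) = fscale (\<psi> l) vac"
  proof
    fix k
    show "\<psi> (l @ k) = fscale (\<psi> l) vac k"
      using max[of "l @ k"] by (cases k) (auto simp: vac_def)
  qed
  then have "fscale (\<psi> l) vac \<in> S" using shift[OF \<psi>(1), of l] by simp
  then have "fscale (inverse (\<psi> l)) (fscale (\<psi> l) vac) \<in> S"
    by (rule functional.subspace_scale[OF sub])
  then show ?thesis using l by (simp flip: mult.assoc)
qed

lemma module: "tw_module fscale Vmod f_act"
proof -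
  have D: "\<psi> \<in> Vmod \<Longrightarrow> \<psi> \<in> D" for \<psi> using Vmod_closed by (auto simp: tw_closed_def)
  show ?thesis
  proof
    show "functional.subspace Vmod" using Vmod_closed by (simp add: tw_closed_def)
    fix X Y \<psi> \<eta> c
    assume X: "X \<in> Ltw" and \<psi>: "\<psi> \<in> Vmod"
    show "f_act X \<psi> \<in> Vmod" using X \<psi> Vmod_closed by (simp add: tw_closed_def)
    show "f_act X (\<psi> + \<eta>) = f_act X \<psi> + f_act X \<eta>"
      by (simp add: f_act_def Wop_add Yop_add Xop_lin)
    show "f_act X (fscale c \<psi>) = fscale c (f_act X \<psi>)"
      by (simp add: f_act_def Wop_scale Yop_scale Xop_lin fun_eq_iff algebra_simps)
    show "f_act (loop_scale c X) \<psi> = fscale c (f_act X \<psi>)"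
      using X D_multilinear[OF D[OF \<psi>]]
      by (simp add: f_act_def sym_entry_scale Wop_lin_left Yop_lin_left Xop_lin_left fun_eq_iff
          algebra_simps)
    assume Y: "Y \<in> Ltw"
    show "f_act (X + Y) \<psi> = f_act X \<psi> + f_act Y \<psi>"
      using X Y D_multilinear[OF D[OF \<psi>]]
      by (simp add: f_act_def sym_entry_add Wop_lin_left Yop_lin_left Xop_lin_left)
    show "f_act (bracket X Y) \<psi> = f_act X (f_act Y \<psi>) - f_act Y (f_act X \<psi>)"
      using X Y D[OF \<psi>] by (rule f_act_bracket)
  qed
qed

end

theorem simple_highest_weight_module_exists:
  assumes "\<phi> \<in> Ltw_zero_dual"
  shows "\<exists>(V :: functional set) act v. simple_highest_weight_module fscale V act \<phi> v"
proof -
  define p where "p P = \<phi> (tensor (Rep_symlaurent P) sl2_h)" for P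
  have zero: "tensor (Rep_symlaurent P) sl2_h \<in> Ltw_zero" for P
    using Rep_symlaurent[of P] by (auto simp: Ltw_zero_eq)
  interpret weight_functional p
  proof
    fix P Q c
    have "tensor (Rep_symlaurent (P + Q)) sl2_h =
        tensor (Rep_symlaurent P) sl2_h + tensor (Rep_symlaurent Q) sl2_h"
      by (simp add: plus_symlaurent.rep_eq vec_eq_iff algebra_simps)
    then show "p (P + Q) = p P + p Q"
      using assms zero by (simp add: p_def Ltw_zero_dual_def)
    have "tensor (Rep_symlaurent (sscale c P)) sl2_h = loop_scale c (tensor (Rep_symlaurent P) sl2_h)"
      by (simp add: sscale.rep_eq vec_eq_iff algebra_simps)
    then show "p (sscale c P) = c * p P"
      using assms zero by (simp add: p_def Ltw_zero_dual_def)
  qed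
  interpret M: tw_module fscale Vmod f_act
    by (rule module)
  have sub: "tw_closed W" if "M.submodule W" for W
    using that Vmod_closed by (auto simp: M.submodule_def tw_closed_def)
  have gen: "W = Vmod" if "M.submodule W" "vac \<in> W" for W
    using Vmod_subset[OF sub] that by (auto simp: M.submodule_def)
  have nz: "vac \<noteq> 0" by (auto simp: vac_def fun_eq_iff)
  have "simple_highest_weight_module fscale Vmod f_act \<phi> vac"
  proof
    show "M.simple_module"
      using gen vac_in_closed[OF sub] nz vac_Vmod unfolding M.simple_module_def by blast
    show "vac \<noteq> 0" by (rule nz)
    show "M.generated_by vac"
      using gen vac_Vmod by (auto simp: M.generated_by_def)
    show "f_act X vac = 0" if "X \<in> Ltw_plus" for X
      using that f_act_tensor(3)[OF _ vac_D] by (auto simp: Ltw_plus_eq Xop_vac)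
    show "f_act X vac = fscale (\<phi> X) vac" if X: "X \<in> Ltw_zero" for X
    proof -
      obtain P where P: "X = tensor P sl2_h" "linv P = P" using X by (auto simp: Ltw_zero_eq)
      then show ?thesis
        using f_act_tensor(4)[OF P(2) vac_D]
        by (simp add: Wop_vac p_def Abs_symlaurent_inverse)
    qed
  qed
  then show ?thesis by blast
qed

end

theory Submission
  imports Defs "HOL-Computational_Algebra.Fundamental_Theorem_Algebra"
begin

text \<open>
  Put \<open>s = t + t\<^sup>-\<^sup>1\<close>. The twisted loop algebra is the current algebra \<open>\<complex>[s] \<otimes> sl\<^sub>2\<close>, and every
  complex number has the form \<open>\<alpha> + \<alpha>\<^sup>-\<^sup>1\<close>, so condition (2) says that the functional
  \<open>P \<mapsto> \<phi> (P(s) \<otimes> h)\<close> on polynomials, written \<open>wt\<close>, is a sum of evaluations.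

  If it is, \<open>V\<close> is a subquotient of a tensor product of two-dimensional evaluation modules.
  Conversely, let \<open>V\<close> be finite-dimensional. The polynomials \<open>Q\<close> with \<open>(Q \<otimes> f) v = 0\<close> form a
  nonzero ideal. If \<open>Q\<^sup>2 \<equiv> \<epsilon> Q\<close> modulo this ideal, then
  \<open>(1 \<otimes> e) (Q \<otimes> f)\<^sup>k\<^sup>+\<^sup>1 v = (k + 1) (wt Q - \<epsilon> k) (Q \<otimes> f)\<^sup>k v\<close>, so finite-dimensionality forces
  \<open>wt Q = \<epsilon> k\<close> for some natural \<open>k\<close>. With \<open>\<epsilon> = 0\<close> this makes the ideal radical; with \<open>\<epsilon> = 1\<close>,
  applied to the Lagrange polynomials at its roots, it gives the multiplicities of the evaluations.
\<close>

section \<open>Polynomials in \<open>t + t\<^sup>-\<^sup>1\<close>\<close>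

definition poly_t :: "complex poly \<Rightarrow> laurent" where
  "poly_t P = poly (map_poly lconst P) t_plus"

lemma poly_t_0 [simp]: "poly_t 0 = 0"
  by (simp add: poly_t_def)

lemma poly_t_pCons [simp]: "poly_t (pCons c P) = lconst c + t_plus * poly_t P"
  by (simp add: poly_t_def map_poly_pCons)

lemma poly_t_add: "poly_t (P + Q) = poly_t P + poly_t Q"
  by (induction P Q rule: poly_induct2) (simp_all add: lconst_add algebra_simps)

lemma poly_t_smult: "poly_t (smult c P) = lconst c * poly_t P"
  by (induction P) (simp_all add: lconst_mult algebra_simps)

lemma poly_t_mult: "poly_t (P * Q) = poly_t P * poly_t Q"
  by (induction P) (simp_all add: poly_t_add poly_t_smult algebra_simps)

lemma poly_t_monom: "poly_t (monom c a) = lconst c * t_plus ^ a"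
  by (induction a) (simp_all add: monom_0 monom_Suc algebra_simps)

lemma linv_poly_t: "linv (poly_t P) = poly_t P"
proof (induction P)
  case (pCons c P)
  then show ?case
    using linv_t_plus_power[of 1] by (simp add: linv_add linv_mult linv_const)
qed simp

lemma symmetric_obtain_poly_t:
  assumes "linv L = L"
  obtains P where "L = poly_t P"
proof -
  have "tp_span \<subseteq> range poly_t"
  proof (rule laurent.span_minimal)
    show "range (\<lambda>a. t_plus ^ a) \<subseteq> range poly_t"
      using poly_t_monom[of 1] by (metis image_subset_iff lconst_1 mult_1 rangeI)
    show "laurent.subspace (range poly_t)"
      unfolding laurent.subspace_def
      by (auto simp flip: poly_t_add poly_t_smult intro: range_eqI[of _ _ 0])
  qed
  then show ?thesis
    using symmetric_in_tp_span[OF assms] that by blast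
qed

section \<open>Polynomial generators of the twisted algebra and their brackets\<close>

definition e_loop :: "complex poly \<Rightarrow> loop" where "e_loop P = tensor (poly_t P) sl2_e"
definition f_loop :: "complex poly \<Rightarrow> loop" where "f_loop P = tensor (poly_t P) sl2_f"
definition h_loop :: "complex poly \<Rightarrow> loop" where "h_loop P = tensor (poly_t P) sl2_h"

lemma efh_loop_Ltw [simp]: "e_loop P \<in> Ltw" "f_loop P \<in> Ltw" "h_loop P \<in> Ltw"
  by (simp_all add: e_loop_def f_loop_def h_loop_def Ltw_iff loop_algebra_iff forall_2
      linv_poly_t linv_uminus lconst_uminus)

lemma e_loop_plus: "e_loop P \<in> Ltw_plus" and h_loop_zero: "h_loop P \<in> Ltw_zero"
  by (auto simp: e_loop_def h_loop_def Ltw_plus_eq Ltw_zero_eq linv_poly_t)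

lemma efh_loop_add:
  "e_loop (P + Q) = e_loop P + e_loop Q"
  "f_loop (P + Q) = f_loop P + f_loop Q"
  "h_loop (P + Q) = h_loop P + h_loop Q"
  by (simp_all add: e_loop_def f_loop_def h_loop_def poly_t_add vec_eq_iff algebra_simps)

lemma efh_loop_smult:
  "e_loop (smult c P) = loop_scale c (e_loop P)"
  "f_loop (smult c P) = loop_scale c (f_loop P)"
  "h_loop (smult c P) = loop_scale c (h_loop P)"
  by (simp_all add: e_loop_def f_loop_def h_loop_def poly_t_smult vec_eq_iff algebra_simps)

lemma w_tw_eq: "w_tw a = h_loop (monom 1 a)"
  by (simp add: w_tw_def h_loop_def poly_t_monom)

lemma tensor_scaleR: "tensor P (r *\<^sub>R A) = loop_scale (of_real r) (tensor P A)"
  by (simp add: vec_eq_iff scaleR_conv_of_real[where 'a = complex] lconst_mult algebra_simps)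

lemma f_loop_0: "f_loop 0 = 0"
  by (simp add: f_loop_def vec_eq_iff)

lemma bracket_e_f: "bracket (e_loop P) (f_loop Q) = h_loop (P * Q)"
  and bracket_h_f: "bracket (h_loop P) (f_loop Q) = loop_scale (-2) (f_loop (P * Q))"
  and bracket_f_f: "bracket (f_loop P) (f_loop Q) = 0"
proof -
  show "bracket (e_loop P) (f_loop Q) = h_loop (P * Q)"
    by (simp add: e_loop_def f_loop_def h_loop_def bracket_tensor sl2_brackets poly_t_mult)
  show "bracket (h_loop P) (f_loop Q) = loop_scale (-2) (f_loop (P * Q))"
    unfolding f_loop_def h_loop_def bracket_tensor sl2_brackets tensor_scaleR poly_t_mult
    by simp
  have "bracket sl2_f sl2_f = 0" by (simp add: bracket_def)
  then show "bracket (f_loop P) (f_loop Q) = 0"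
    by (simp add: f_loop_def bracket_tensor vec_eq_iff)
qed

lemma Ltw_obtain:
  assumes "L \<in> Ltw"
  obtains A B C where "L = h_loop A + e_loop B + f_loop C"
proof -
  have L: "L \<in> loop_algebra" "\<And>i j. linv (L $ i $ j) = L $ i $ j"
    using assms by (simp_all add: Ltw_iff)
  obtain A B C where "L $ 1 $ 1 = poly_t A" "L $ 1 $ 2 = poly_t B" "L $ 2 $ 1 = poly_t C"
    using symmetric_obtain_poly_t[OF L(2)] by metis
  then show ?thesis
    using that tensor_decomposition[OF L(1)] by (simp add: e_loop_def f_loop_def h_loop_def)
qed


section \<open>Tensor products of evaluation modules\<close>

text \<open>
  The tensor product over \<open>i \<in> I\<close> of copies of the natural two-dimensional module, with
  \<open>s\<close> acting on the \<open>i\<close>-th factor by \<open>\<beta> i\<close>: \<open>m S\<close> is the coefficient of the basis tensor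
  having the lowest weight vector exactly in the positions \<open>S \<subseteq> I\<close>.
\<close>

definition spin_vac :: "nat set \<Rightarrow> complex" where
  "spin_vac S = (if S = {} then 1 else 0)"

definition spin_e ::
    "nat set \<Rightarrow> (nat \<Rightarrow> complex) \<Rightarrow> complex poly \<Rightarrow> (nat set \<Rightarrow> complex) \<Rightarrow> nat set \<Rightarrow> complex" where
  "spin_e I \<beta> P m S = (\<Sum>i\<in>I - S. poly P (\<beta> i) * m (insert i S))"

definition spin_f ::
    "nat set \<Rightarrow> (nat \<Rightarrow> complex) \<Rightarrow> complex poly \<Rightarrow> (nat set \<Rightarrow> complex) \<Rightarrow> nat set \<Rightarrow> complex" where
  "spin_f I \<beta> P m S = (\<Sum>i\<in>I \<inter> S. poly P (\<beta> i) * m (S - {i}))"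

definition spin_h ::
    "nat set \<Rightarrow> (nat \<Rightarrow> complex) \<Rightarrow> complex poly \<Rightarrow> (nat set \<Rightarrow> complex) \<Rightarrow> nat set \<Rightarrow> complex" where
  "spin_h I \<beta> P m S = ((\<Sum>i\<in>I - S. poly P (\<beta> i)) - (\<Sum>i\<in>I \<inter> S. poly P (\<beta> i))) * m S"

lemma spin_add:
  "spin_e I \<beta> P (m + m') = spin_e I \<beta> P m + spin_e I \<beta> P m'"
  "spin_f I \<beta> P (m + m') = spin_f I \<beta> P m + spin_f I \<beta> P m'"
  "spin_h I \<beta> P (m + m') = spin_h I \<beta> P m + spin_h I \<beta> P m'"
  by (simp_all add: fun_eq_iff spin_e_def spin_f_def spin_h_def algebra_simps sum.distrib)

lemma spin_scale:
  "spin_e I \<beta> P (\<lambda>S. c * m S) = (\<lambda>S. c * spin_e I \<beta> P m S)"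
  "spin_f I \<beta> P (\<lambda>S. c * m S) = (\<lambda>S. c * spin_f I \<beta> P m S)"
  "spin_h I \<beta> P (\<lambda>S. c * m S) = (\<lambda>S. c * spin_h I \<beta> P m S)"
  by (simp_all add: fun_eq_iff spin_e_def spin_f_def spin_h_def sum_distrib_left algebra_simps)

lemma spin_zero:
  "spin_e I \<beta> P 0 = 0" "spin_f I \<beta> P 0 = 0" "spin_h I \<beta> P 0 = 0"
  by (simp_all add: fun_eq_iff spin_e_def spin_f_def spin_h_def)

lemma spin_e_vac: "spin_e I \<beta> P spin_vac = 0"
  by (simp add: fun_eq_iff spin_e_def spin_vac_def)

lemma spin_h_vac: "spin_h I \<beta> P spin_vac = (\<lambda>S. (\<Sum>i\<in>I. poly P (\<beta> i)) * spin_vac S)"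
  by (simp add: fun_eq_iff spin_h_def spin_vac_def)

text \<open>\<open>spin_h\<close> multiplies the coefficient at \<open>S\<close> by a scalar. Taking
  \<open>i\<close> out of \<open>S\<close> moves one term from the negative to the positive sum,
  which raises this scalar by \<open>2 * poly P (\<beta> i)\<close>.\<close>

lemma spin_h_f:
  assumes "finite I"
  shows "spin_h I \<beta> P (spin_f I \<beta> Q m) =
    spin_f I \<beta> Q (spin_h I \<beta> P m) + (\<lambda>S. -2 * spin_f I \<beta> (P * Q) m S)"
proof
  fix S
  let ?p = "\<lambda>i. poly P (\<beta> i)" and ?q = "\<lambda>i. poly Q (\<beta> i)"
  define h where "h S = (\<Sum>i\<in>I - S. ?p i) - (\<Sum>i\<in>I \<inter> S. ?p i)" for S
  have h: "h (S - {i}) = h S + 2 * ?p i" if "i \<in> I \<inter> S" for i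
  proof -
    have "I - (S - {i}) = insert i (I - S)" "I \<inter> (S - {i}) = (I \<inter> S) - {i}"
      using that by auto
    then show ?thesis
      using that assms by (simp add: h_def sum.remove[of "I \<inter> S" i ?p])
  qed
  have "spin_f I \<beta> Q (spin_h I \<beta> P m) S =
      (\<Sum>i\<in>I \<inter> S. ?q i * (h (S - {i}) * m (S - {i})))"
    by (simp add: spin_f_def spin_h_def h_def)
  also have "\<dots> = (\<Sum>i\<in>I \<inter> S. h S * (?q i * m (S - {i})) + 2 * (?p i * ?q i * m (S - {i})))"
    by (intro sum.cong refl) (simp add: h algebra_simps)
  also have "\<dots> = spin_h I \<beta> P (spin_f I \<beta> Q m) S + 2 * spin_f I \<beta> (P * Q) m S"
    by (simp add: sum.distrib spin_f_def spin_h_def h_def flip: sum_distrib_left)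
  finally show "spin_h I \<beta> P (spin_f I \<beta> Q m) S =
      (spin_f I \<beta> Q (spin_h I \<beta> P m) + (\<lambda>S. -2 * spin_f I \<beta> (P * Q) m S)) S"
    by simp
qed

text \<open>Raising at \<open>i\<close> and lowering at \<open>j\<close> commute for distinct
  positions and contribute the same double sum \<open>C\<close> in both orders. The terms with equal
  positions differ by the \<open>spin_h\<close> scalar of \<open>P * Q\<close>.\<close>

lemma spin_e_f:
  assumes "finite I"
  shows "spin_e I \<beta> P (spin_f I \<beta> Q m) =
    spin_f I \<beta> Q (spin_e I \<beta> P m) + spin_h I \<beta> (P * Q) m"
proof
  fix S
  let ?p = "\<lambda>i. poly P (\<beta> i)" and ?q = "\<lambda>i. poly Q (\<beta> i)"
  define C where "C = (\<Sum>i\<in>I - S. \<Sum>j\<in>I \<inter> S. ?p i * ?q j * m (insert i (S - {j})))"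
  have "(\<Sum>j\<in>I \<inter> insert i S. ?q j * m (insert i S - {j})) =
      ?q i * m S + (\<Sum>j\<in>I \<inter> S. ?q j * m (insert i (S - {j})))" if "i \<in> I - S" for i
  proof -
    have "I \<inter> insert i S = insert i (I \<inter> S)" using that by auto
    moreover have "insert i S - {j} = insert i (S - {j})" if "j \<in> S" for j
      using that \<open>i \<in> I - S\<close> by auto
    ultimately show ?thesis
      using that assms by (simp cong: sum.cong_simp)
  qed
  then have "spin_e I \<beta> P (spin_f I \<beta> Q m) S =
      (\<Sum>i\<in>I - S. ?p i * (?q i * m S + (\<Sum>j\<in>I \<inter> S. ?q j * m (insert i (S - {j})))))"
    by (simp add: spin_e_def spin_f_def)
  also have "\<dots> = (\<Sum>i\<in>I - S. ?p i * ?q i) * m S + C"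
    by (simp add: C_def distrib_left sum.distrib sum_distrib_left sum_distrib_right mult.assoc)
  finally have ef: "spin_e I \<beta> P (spin_f I \<beta> Q m) S = (\<Sum>i\<in>I - S. ?p i * ?q i) * m S + C" .
  have "(\<Sum>i\<in>I - (S - {j}). ?p i * m (insert i (S - {j}))) =
      ?p j * m S + (\<Sum>i\<in>I - S. ?p i * m (insert i (S - {j})))" if "j \<in> I \<inter> S" for j
  proof -
    have "I - (S - {j}) = insert j (I - S)" "insert j (S - {j}) = S" using that by auto
    then show ?thesis
      using that assms by simp
  qed
  then have "spin_f I \<beta> Q (spin_e I \<beta> P m) S =
      (\<Sum>j\<in>I \<inter> S. ?q j * (?p j * m S + (\<Sum>i\<in>I - S. ?p i * m (insert i (S - {j})))))"
    by (simp add: spin_e_def spin_f_def)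
  also have "\<dots> = (\<Sum>j\<in>I \<inter> S. ?p j * ?q j) * m S + C"
    unfolding C_def
    by (subst sum.swap)
      (simp add: distrib_left sum.distrib sum_distrib_left sum_distrib_right mult_ac)
  finally show "spin_e I \<beta> P (spin_f I \<beta> Q m) S =
      (spin_f I \<beta> Q (spin_e I \<beta> P m) + spin_h I \<beta> (P * Q) m) S"
    by (simp add: ef spin_h_def left_diff_distrib)
qed

section \<open>Simple highest weight modules\<close>

text \<open>Roots are split off one at a time; as they are distinct, the quotient still vanishes at
  the remaining ones.\<close>

lemma prod_linear_dvd:
  fixes P :: "complex poly"
  assumes "finite B" "\<And>\<beta>. \<beta> \<in> B \<Longrightarrow> poly P \<beta> = 0"
  shows "(\<Prod>\<beta>\<in>B. [:-\<beta>, 1:]) dvd P"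
  using assms
proof (induction B arbitrary: P)
  case (insert x B)
  obtain Q where Q: "P = [:-x, 1:] * Q"
    using insert.prems[of x] by (auto simp: poly_eq_0_iff_dvd dvd_def)
  have "(\<Prod>\<beta>\<in>B. [:-\<beta>, 1:]) dvd Q"
    using insert.hyps insert.prems by (intro insert.IH) (auto simp: Q)
  then show ?case using insert.hyps by (simp add: Q del: mult_pCons_left)
qed simp

context simple_highest_weight_module
begin

lemma v_V [simp]: "v \<in> V"
  using v_generates by (simp add: generated_by_def)

lemma V_closed [simp]:
  "0 \<in> V" "u \<in> V \<Longrightarrow> u' \<in> V \<Longrightarrow> u + u' \<in> V" "u \<in> V \<Longrightarrow> u' \<in> V \<Longrightarrow> u - u' \<in> V"
  "u \<in> V \<Longrightarrow> scl c u \<in> V" "L \<in> Ltw \<Longrightarrow> u \<in> V \<Longrightarrow> act L u \<in> V"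
  using V_subspace act_closed subspace_diff by (auto simp: subspace_def)

lemma act_zero: "L \<in> Ltw \<Longrightarrow> act L 0 = 0"
  using act_scale[of L 0 0] by simp

lemma act_diff: "L \<in> Ltw \<Longrightarrow> u \<in> V \<Longrightarrow> u' \<in> V \<Longrightarrow> act L (u - u') = act L u - act L u'"
  using act_add[of L "u - u'" u'] by simp

lemma act_f_add: "u \<in> V \<Longrightarrow> act (f_loop (P + Q)) u = act (f_loop P) u + act (f_loop Q) u"
  by (simp add: efh_loop_add add_act)

lemma act_f_smult: "u \<in> V \<Longrightarrow> act (f_loop (smult c P)) u = scl c (act (f_loop P) u)"
  by (simp add: efh_loop_smult scale_act)

lemma act_f_0: "u \<in> V \<Longrightarrow> act (f_loop 0) u = 0"
  using act_f_smult[of u 0 0] by simp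

lemma act_e_f:
  "u \<in> V \<Longrightarrow> act (e_loop P) (act (f_loop Q) u) =
    act (f_loop Q) (act (e_loop P) u) + act (h_loop (P * Q)) u"
  using bracket_act[of "e_loop P" "f_loop Q" u] by (simp add: bracket_e_f)

lemma act_h_f:
  "u \<in> V \<Longrightarrow> act (h_loop P) (act (f_loop Q) u) =
    act (f_loop Q) (act (h_loop P) u) - scl 2 (act (f_loop (P * Q)) u)"
  using bracket_act[of "h_loop P" "f_loop Q" u]
    scale_act[of "f_loop (P * Q)" u "-2"]
  by (simp add: bracket_h_f algebra_simps)

lemma act_f_f:
  assumes "u \<in> V"
  shows "act (f_loop P) (act (f_loop Q) u) = act (f_loop Q) (act (f_loop P) u)"
proof -
  have "act (bracket (f_loop P) (f_loop Q)) u = 0"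
    using act_f_0[OF assms] by (simp add: bracket_f_f f_loop_0)
  then show ?thesis
    using bracket_act[of "f_loop P" "f_loop Q" u] assms by simp
qed

section \<open>The highest weight as a linear functional on polynomials\<close>

definition wt :: "complex poly \<Rightarrow> complex" where
  "wt P = \<phi> (h_loop P)"

lemma act_e_v: "act (e_loop P) v = 0"
  by (simp add: v_plus e_loop_plus)

lemma act_h_v: "act (h_loop P) v = scl (wt P) v"
  by (simp add: v_weight h_loop_zero wt_def)

lemma wt_add: "wt (P + Q) = wt P + wt Q"
proof -
  have "scl (wt (P + Q)) v = scl (wt P + wt Q) v"
    by (simp flip: act_h_v add: efh_loop_add add_act scale_left_distrib)
  then show ?thesis using v_nonzero by simp
qed

lemma wt_smult: "wt (smult c P) = c * wt P"
proof -
  have "scl (wt (smult c P)) v = scl c (act (h_loop P) v)"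
    by (simp flip: act_h_v add: efh_loop_smult scale_act)
  also have "\<dots> = scl (c * wt P) v" by (simp add: act_h_v)
  finally show ?thesis using v_nonzero by simp
qed

lemma wt_sum: "wt (\<Sum>i\<in>I. smult (c i) (P i)) = (\<Sum>i\<in>I. c i * wt (P i))"
proof (induction I rule: infinite_finite_induct)
  case (infinite I)
  then show ?case using wt_smult[of 0 0] by simp
next
  case empty
  then show ?case using wt_smult[of 0 0] by simp
qed (simp add: wt_add wt_smult)

lemma submoduleI:
  assumes "N \<subseteq> V" "subspace N"
    and "\<And>P u. u \<in> N \<Longrightarrow> act (e_loop P) u \<in> N"
    and "\<And>P u. u \<in> N \<Longrightarrow> act (f_loop P) u \<in> N"
    and "\<And>P u. u \<in> N \<Longrightarrow> act (h_loop P) u \<in> N"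
  shows "submodule N"
  unfolding submodule_def
proof (intro conjI ballI assms(1,2))
  fix L u assume "L \<in> Ltw" and u: "u \<in> N"
  then obtain A B C where L: "L = h_loop A + e_loop B + f_loop C"
    using Ltw_obtain by blast
  have "h_loop A + e_loop B \<in> Ltw"
    by (metis Ltw_eq_span efh_loop_Ltw(1,3) loop.span_add)
  then have "act L u = act (h_loop A) u + act (e_loop B) u + act (f_loop C) u"
    using L u assms(1) by (simp add: add_act subsetD)
  then show "act L u \<in> N"
    using u assms by (simp add: subspace_add)
qed

lemma generated_eq: "submodule N \<Longrightarrow> v \<in> N \<Longrightarrow> N = V"
  using v_generates by (simp add: generated_by_def)


subsection \<open>Weights below the highest one\<close>

text \<open>
  \<open>lower k\<close> is the product of \<open>h - (\<lambda> - 2j)\<close> for \<open>j = 1, \<dots>, k\<close>, where \<open>\<lambda>\<close> is the highest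
  weight; it annihilates the weights \<open>\<lambda> - 2, \<dots>, \<lambda> - 2k\<close> but not \<open>v\<close>.
\<close>

primrec lower :: "nat \<Rightarrow> 'v \<Rightarrow> 'v" where
  "lower 0 u = u"
| "lower (Suc k) u =
    act (h_loop 1) (lower k u) - scl (wt 1 - 2 * of_nat (Suc k)) (lower k u)"

lemma lower_V [simp]: "u \<in> V \<Longrightarrow> lower k u \<in> V"
  by (induction k) simp_all

lemma lower_add: "u \<in> V \<Longrightarrow> u' \<in> V \<Longrightarrow> lower k (u + u') = lower k u + lower k u'"
  by (induction k) (simp_all add: act_add scale_right_distrib algebra_simps del: of_nat_Suc)

lemma lower_scale: "u \<in> V \<Longrightarrow> lower k (scl c u) = scl c (lower k u)"
  by (induction k) (simp_all add: act_scale scale_right_diff_distrib mult.commute del: of_nat_Suc)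

text \<open>The factor with index \<open>j\<close> acts on \<open>v\<close> as \<open>2 * j\<close>,
  so the product never kills \<open>v\<close>.\<close>

lemma lower_v: "lower k v = scl (2 ^ k * fact k) v"
proof (induction k)
  case (Suc k)
  then show ?case
    by (simp add: act_scale act_h_v flip: scale_left_diff_distrib) (simp add: algebra_simps)
qed simp

text \<open>Moving \<open>f_loop P\<close> to the left past the factor with index \<open>j\<close>
  turns it into the one with index \<open>j - 1\<close>. Indices \<open>1, ..., k + 1\<close> become
  \<open>0, ..., k\<close>, and index 0 is \<open>h\<close> minus the highest weight.\<close>

lemma lower_f:
  assumes "u \<in> V"
  shows "lower (Suc k) (act (f_loop P) u) =
    act (f_loop P) (act (h_loop 1) (lower k u) - scl (wt 1) (lower k u))"
proof (induction k)
  case 0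
  then show ?case
    using assms
    by (simp add: act_h_f act_diff act_scale scale_left_diff_distrib)
next
  case (Suc k)
  let ?T = "act (h_loop 1)" and ?f = "act (f_loop P)"
  define a where "a = lower k u"
  define z where "z = ?T a - scl (wt 1) a"
  define c where "c = wt 1 - 2 * of_nat (Suc k)"
  have V: "a \<in> V" "z \<in> V" using assms by (simp_all add: a_def z_def)
  have c: "wt 1 - 2 * of_nat (Suc (Suc k)) = c - 2" by (simp add: c_def)
  have "lower (Suc (Suc k)) (?f u) =
      ?T (lower (Suc k) (?f u)) - scl (c - 2) (lower (Suc k) (?f u))"
    by (simp only: lower.simps c)
  also have "\<dots> = ?T (?f z) - scl (c - 2) (?f z)"
    by (simp only: Suc.IH z_def a_def)
  also have "\<dots> = ?f (?T z - scl c z)"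
    using V by (simp add: act_h_f act_diff act_scale scale_left_diff_distrib)
  also have "?T z - scl c z = ?T (?T a - scl c a) - scl (wt 1) (?T a - scl c a)"
    using V by (simp add: z_def act_diff act_scale scale_right_diff_distrib mult.commute)
  also have "?T a - scl c a = lower (Suc k) u"
    by (simp add: a_def c_def)
  finally show ?case .
qed

text \<open>This replaces a weight space argument: by \<open>lower_v\<close>, such a submodule
  cannot contain \<open>v\<close>, so simplicity leaves only \<open>{0}\<close>.\<close>

lemma lower_submodule:
  assumes "submodule N" and "\<And>u. u \<in> N \<Longrightarrow> \<exists>k. lower k u = 0"
  shows "N = {0}"
proof (rule ccontr)
  assume "N \<noteq> {0}"
  then have "N = V" using simple assms(1) by (auto simp: simple_module_def)
  then show False
    using assms(2)[of v] v_nonzero by (auto simp: lower_v)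
qed

text \<open>The submodule generated by the vectors \<open>(Q \<otimes> f) v\<close> that all \<open>A \<otimes> e\<close> annihilate.\<close>

inductive_set singular_part :: "'v set" where
  base: "(\<And>A. wt (A * Q) = 0) \<Longrightarrow> act (f_loop Q) v \<in> singular_part"
| f: "u \<in> singular_part \<Longrightarrow> act (f_loop P) u \<in> singular_part"
| add: "u \<in> singular_part \<Longrightarrow> u' \<in> singular_part \<Longrightarrow> u + u' \<in> singular_part"
| scale: "u \<in> singular_part \<Longrightarrow> scl c u \<in> singular_part"

lemma singular_part_V: "u \<in> singular_part \<Longrightarrow> u \<in> V"
  by (induction rule: singular_part.induct) simp_all

lemma singular_part_subspace: "subspace singular_part"
proof -
  \<comment> \<open>The zero vector arises from the polynomial 0, which meets the condition of
    \<open>base\<close>.\<close>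
  have "scl 0 (act (f_loop 0) v) \<in> singular_part"
    using wt_smult[of 0 0] by (intro singular_part.intros) simp
  then show ?thesis
    by (auto simp: subspace_def intro: singular_part.intros)
qed

lemma singular_part_h: "u \<in> singular_part \<Longrightarrow> act (h_loop P) u \<in> singular_part"
proof (induction arbitrary: P rule: singular_part.induct)
  case (base Q)
  \<comment> \<open>The condition of \<open>base\<close> passes to multiples of \<open>Q\<close>, so
    the commutator term is again a generator.\<close>
  have "wt (A * (P * Q)) = 0" for A using base[of "A * P"] by (simp add: mult.assoc)
  then show ?case
    using base
    by (simp add: act_h_f act_h_v act_scale subspace_diff[OF singular_part_subspace]
        singular_part.intros)
next
  case (f u Q)
  then show ?case
    by (simp add: act_h_f singular_part_V subspace_diff[OF singular_part_subspace]
        singular_part.intros)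
qed (simp_all add: act_add act_scale singular_part_V singular_part.intros)

lemma singular_part_e: "u \<in> singular_part \<Longrightarrow> act (e_loop P) u \<in> singular_part"
proof (induction arbitrary: P rule: singular_part.induct)
  case (base Q)
  then show ?case
    by (simp add: act_e_f act_e_v act_h_v act_zero subspace_0[OF singular_part_subspace])
next
  case (f u Q)
  then show ?case
    by (simp add: act_e_f singular_part_V singular_part_h singular_part.intros)
qed (simp_all add: act_add act_scale singular_part_V singular_part.intros)

text \<open>Vanishing for all large \<open>k\<close> lets two summands share a bound. A generator
  dies because \<open>lower k v\<close> is a multiple of \<open>v\<close>, killed by the index 0
  factor that \<open>lower_f\<close> produces.\<close>

lemma singular_part_lower: "u \<in> singular_part \<Longrightarrow> \<exists>K. \<forall>k\<ge>K. lower k u = 0"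
proof (induction rule: singular_part.induct)
  case (base Q)
  have "lower (Suc k) (act (f_loop Q) v) = 0" for k
    unfolding lower_f[OF v_V] by (simp add: lower_v act_scale act_h_v mult.commute act_zero)
  then show ?case by (metis Suc_le_D One_nat_def)
next
  case (f u P)
  then obtain K where "\<forall>k\<ge>K. lower k u = 0" by blast
  then have "\<forall>k\<ge>K. lower (Suc k) (act (f_loop P) u) = 0"
    using f.hyps by (simp add: lower_f singular_part_V act_zero del: lower.simps)
  then show ?case by (metis Suc_le_D Suc_le_mono)
next
  case (add u u')
  then obtain K K' where "\<forall>k\<ge>K. lower k u = 0" "\<forall>k\<ge>K'. lower k u' = 0" by blast
  then show ?case
    using add.hyps by (intro exI[of _ "max K K'"]) (simp add: lower_add singular_part_V)
next
  case (scale u c)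
  then show ?case by (auto simp: lower_scale singular_part_V)
qed

text \<open>The vector lies in \<open>singular_part\<close>, a submodule that is zero by
  \<open>lower_submodule\<close>. This is how simplicity turns information on \<open>wt\<close> into
  relations in \<open>V\<close>.\<close>

lemma act_f_v_eq_0:
  assumes "\<And>A. wt (A * Q) = 0"
  shows "act (f_loop Q) v = 0"
proof -
  have "submodule singular_part"
    using singular_part_V
    by (intro submoduleI singular_part_subspace singular_part_h singular_part_e singular_part.f) auto
  then have "singular_part = {0}"
    using singular_part_lower by (intro lower_submodule) blast+
  then show ?thesis using singular_part.base[OF assms] by blast
qed


subsection \<open>Finite-dimensionality\<close>

text \<open>
  The submodule generated by the pair of highest weight vectors in the product of \<open>V\<close> with the
  tensor product of evaluation modules, as a relation.
\<close>

inductive spin_rel :: "nat set \<Rightarrow> (nat \<Rightarrow> complex) \<Rightarrow> 'v \<Rightarrow> (nat set \<Rightarrow> complex) \<Rightarrow> bool"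
  for I \<beta> where
  vac: "spin_rel I \<beta> v spin_vac"
| f: "spin_rel I \<beta> u m \<Longrightarrow> spin_rel I \<beta> (act (f_loop P) u) (spin_f I \<beta> P m)"
| add: "spin_rel I \<beta> u m \<Longrightarrow> spin_rel I \<beta> u' m' \<Longrightarrow> spin_rel I \<beta> (u + u') (m + m')"
| scale: "spin_rel I \<beta> u m \<Longrightarrow> spin_rel I \<beta> (scl c u) (\<lambda>S. c * m S)"

section \<open>Sums of evaluations give finite-dimensional modules\<close>

lemma spin_rel_V: "spin_rel I \<beta> u m \<Longrightarrow> u \<in> V"
  by (induction rule: spin_rel.induct) simp_all

lemma spin_rel_zero: "spin_rel I \<beta> 0 0"
  using spin_rel.scale[OF spin_rel.vac, of I \<beta> 0] by (simp add: zero_fun_def)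

lemma spin_rel_diff:
  assumes "spin_rel I \<beta> u m" "spin_rel I \<beta> u' m'"
  shows "spin_rel I \<beta> (u - scl c u') (\<lambda>S. m S - c * m' S)"
  using spin_rel.add[OF assms(1) spin_rel.scale[OF assms(2), of "-c"]]
  by (simp add: plus_fun_def)

lemma spin_rel_support:
  assumes "spin_rel I \<beta> u m" "m S \<noteq> 0"
  shows "S \<subseteq> I"
  using assms
proof (induction arbitrary: S rule: spin_rel.induct)
  case (f u m P)
  then obtain i where "i \<in> I \<inter> S" "m (S - {i}) \<noteq> 0"
    unfolding spin_f_def by (metis (no_types, lifting) mult_zero_right sum.neutral)
  then show ?case using f.IH by blast
next
  case (add u m u' m')
  then have "m S \<noteq> 0 \<or> m' S \<noteq> 0" by auto
  then show ?case using add.IH by blast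
qed (auto simp: spin_vac_def split: if_splits)

text \<open>The assumption on \<open>wt\<close> gives both highest weight vectors the same weight,
  which settles \<open>vac\<close>; the case \<open>f\<close> uses the same commutator on both
  sides.\<close>

lemma spin_rel_h:
  assumes "spin_rel I \<beta> u m" "finite I" "\<And>P. wt P = (\<Sum>i\<in>I. poly P (\<beta> i))"
  shows "spin_rel I \<beta> (act (h_loop P) u) (spin_h I \<beta> P m)"
  using assms(1)
proof (induction arbitrary: P rule: spin_rel.induct)
  case vac
  then show ?case
    by (simp add: act_h_v spin_h_vac assms(3) spin_rel.intros)
next
  case (f u m Q)
  have "spin_rel I \<beta> (act (f_loop Q) (act (h_loop P) u) + scl (-2) (act (f_loop (P * Q)) u))
      (spin_f I \<beta> Q (spin_h I \<beta> P m) + (\<lambda>S. -2 * spin_f I \<beta> (P * Q) m S))"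
    using f by (intro spin_rel.intros)
  then show ?case
    using f.hyps by (simp add: act_h_f spin_h_f[OF assms(2)] spin_rel_V plus_fun_def)
qed (simp_all add: act_add act_scale spin_rel_V spin_add spin_scale spin_rel.intros)

lemma spin_rel_e:
  assumes "spin_rel I \<beta> u m" "finite I" "\<And>P. wt P = (\<Sum>i\<in>I. poly P (\<beta> i))"
  shows "spin_rel I \<beta> (act (e_loop P) u) (spin_e I \<beta> P m)"
  using assms(1)
proof (induction arbitrary: P rule: spin_rel.induct)
  case vac
  then show ?case
    using spin_rel_zero by (simp add: act_e_v spin_e_vac zero_fun_def)
next
  case (f u m Q)
  then show ?case
    using assms spin_rel.add[OF spin_rel.f[OF f.IH, of Q P] spin_rel_h[OF f.hyps assms(2,3), of "P * Q"]]
    by (simp add: act_e_f spin_e_f spin_rel_V plus_fun_def)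
qed (simp_all add: act_add act_scale spin_rel_V spin_add spin_scale spin_rel.intros)

text \<open>Both sides see only the top weight: \<open>m {}\<close> plays the role of the
  coefficient of \<open>v\<close> in \<open>u\<close>, and everything reached through
  \<open>f\<close> is eventually killed.\<close>

lemma spin_rel_lower:
  assumes "spin_rel I \<beta> u m"
  shows "\<exists>K. \<forall>k\<ge>K. lower k u = scl (m {}) (lower k v)"
  using assms
proof (induction rule: spin_rel.induct)
  case vac
  then show ?case by (simp add: spin_vac_def)
next
  case (f u m P)
  then obtain K where "\<forall>k\<ge>K. lower k u = scl (m {}) (lower k v)" by blast
  then have "\<forall>k\<ge>K. lower (Suc k) (act (f_loop P) u) = 0"
    using f.hyps
    by (simp add: lower_f spin_rel_V lower_v act_scale act_h_v act_zero mult_ac del: lower.simps)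
  moreover have "spin_f I \<beta> P m {} = 0" by (simp add: spin_f_def)
  ultimately have "lower k (act (f_loop P) u) = scl (spin_f I \<beta> P m {}) (lower k v)"
    if "k \<ge> Suc K" for k
    using that by (cases k) (auto simp del: lower.simps)
  then show ?case by blast
next
  case (add u m u' m')
  then obtain K K' where "\<forall>k\<ge>K. lower k u = scl (m {}) (lower k v)"
    "\<forall>k\<ge>K'. lower k u' = scl (m' {}) (lower k v)" by blast
  then show ?case
    using add.hyps
    by (intro exI[of _ "max K K'"]) (simp add: lower_add spin_rel_V scale_left_distrib)
next
  case (scale u m c)
  then obtain K where "\<forall>k\<ge>K. lower k u = scl (m {}) (lower k v)" by blast
  then show ?case
    using scale.hyps by (intro exI[of _ K]) (simp add: lower_scale spin_rel_V)
qed

text \<open>The vectors related to 0 form a submodule that \<open>lower\<close> eventually kills. By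
  linearity \<open>m\<close> then determines \<open>u\<close>, so \<open>V\<close> is a quotient of
  a submodule of the tensor product.\<close>

lemma spin_rel_inj:
  assumes "spin_rel I \<beta> u 0" "finite I" "\<And>P. wt P = (\<Sum>i\<in>I. poly P (\<beta> i))"
  shows "u = 0"
proof -
  let ?N = "{u. spin_rel I \<beta> u 0}"
  have "submodule ?N"
  proof (rule submoduleI)
    show "?N \<subseteq> V" using spin_rel_V by blast
    have "spin_rel I \<beta> (u + u') 0" if "spin_rel I \<beta> u 0" "spin_rel I \<beta> u' 0" for u u'
      using spin_rel.add[OF that] by simp
    moreover have "spin_rel I \<beta> (scl c u) 0" if "spin_rel I \<beta> u 0" for c u
      using spin_rel.scale[OF that, of c] by (simp add: zero_fun_def)
    ultimately show "subspace ?N"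
      using spin_rel_zero by (simp add: subspace_def)
    fix P u assume "u \<in> ?N"
    then have u: "spin_rel I \<beta> u 0" by simp
    show "act (e_loop P) u \<in> ?N"
      using spin_rel_e[OF u assms(2,3), of P] by (simp only: spin_zero mem_Collect_eq)
    show "act (f_loop P) u \<in> ?N"
      using spin_rel.f[OF u, of P] by (simp only: spin_zero mem_Collect_eq)
    show "act (h_loop P) u \<in> ?N"
      using spin_rel_h[OF u assms(2,3), of P] by (simp only: spin_zero mem_Collect_eq)
  qed
  then have "?N = {0}"
  proof (rule lower_submodule)
    fix u assume "u \<in> ?N"
    then show "\<exists>k. lower k u = 0" using spin_rel_lower[of I \<beta> u 0] by auto
  qed
  then show ?thesis using assms(1) by blast
qed

text \<open>Gaussian elimination over the allowed support: each new index \<open>T\<close> costs at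
  most one further spanning vector, and empty support forces \<open>u = 0\<close> by
  \<open>spin_rel_inj\<close>.\<close>

lemma finite_span_support:
  assumes "finite \<S>" "finite I" "\<And>P. wt P = (\<Sum>i\<in>I. poly P (\<beta> i))"
  shows "\<exists>B. finite B \<and> B \<subseteq> V \<and>
    (\<forall>u m. spin_rel I \<beta> u m \<longrightarrow> (\<forall>S. m S \<noteq> 0 \<longrightarrow> S \<in> \<S>) \<longrightarrow> u \<in> span B)"
  using assms(1)
proof induction
  case empty
  have "u = 0" if "spin_rel I \<beta> u m" "\<forall>S. m S = 0" for u m
  proof -
    have "m = 0" using that(2) by auto
    then show ?thesis using that(1) spin_rel_inj assms(2,3) by blast
  qed
  then show ?case by (intro exI[of _ "{}"]) auto
next
  case (insert T \<S>)
  then obtain B where B: "finite B" "B \<subseteq> V"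
    "\<And>u m. spin_rel I \<beta> u m \<Longrightarrow> \<forall>S. m S \<noteq> 0 \<longrightarrow> S \<in> \<S> \<Longrightarrow> u \<in> span B"
    by blast
  show ?case
  proof (cases "\<exists>u m. spin_rel I \<beta> u m \<and> (\<forall>S. m S \<noteq> 0 \<longrightarrow> S \<in> insert T \<S>) \<and> m T \<noteq> 0")
    case False
    have "u \<in> span B" if "spin_rel I \<beta> u m" "\<forall>S. m S \<noteq> 0 \<longrightarrow> S \<in> insert T \<S>" for u m
    proof -
      have "m T = 0" using False that by blast
      then have "\<forall>S. m S \<noteq> 0 \<longrightarrow> S \<in> \<S>" using that(2) by auto
      then show ?thesis using B(3) that(1) by blast
    qed
    then show ?thesis using B(1,2) by blast
  next
    case True
    then obtain u0 m0 where u0: "spin_rel I \<beta> u0 m0" "\<forall>S. m0 S \<noteq> 0 \<longrightarrow> S \<in> insert T \<S>" "m0 T \<noteq> 0"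
      by blast
    have "u \<in> span (insert u0 B)"
      if u: "spin_rel I \<beta> u m" "\<forall>S. m S \<noteq> 0 \<longrightarrow> S \<in> insert T \<S>" for u m
    proof -
      \<comment> \<open>Chosen so that subtracting this multiple of \<open>u0\<close> cancels the
        coefficient at \<open>T\<close>.\<close>
      let ?c = "m T / m0 T"
      have "S \<in> \<S>" if "m S - ?c * m0 S \<noteq> 0" for S
      proof -
        have "m S \<noteq> 0 \<or> m0 S \<noteq> 0" using that by auto
        moreover have "S \<noteq> T" using that u0(3) by auto
        ultimately show ?thesis using u(2) u0(2) by blast
      qed
      then have "u - scl ?c u0 \<in> span B"
        by (intro B(3)[OF spin_rel_diff[OF u(1) u0(1)]]) blast
      then show ?thesis by (auto simp: span_insert)
    qed
    then show ?thesis
      using B(1,2) spin_rel_V[OF u0(1)] by (intro exI[of _ "insert u0 B"]) auto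
  qed
qed

text \<open>The vectors occurring in the relation form a submodule containing \<open>v\<close>,
  hence all of \<open>V\<close>, and the supports lie in the finite set
  \<open>Pow I\<close>.\<close>

lemma finite_dimensional_if_evaluations:
  fixes I :: "nat set" and \<beta> :: "nat \<Rightarrow> complex"
  assumes "finite I" "\<And>P. wt P = (\<Sum>i\<in>I. poly P (\<beta> i))"
  shows "finite_dimensional scl V"
proof -
  let ?N = "{u. \<exists>m. spin_rel I \<beta> u m}"
  have "submodule ?N"
  proof (rule submoduleI)
    show "?N \<subseteq> V" using spin_rel_V by blast
    show "subspace ?N"
      unfolding subspace_def
    proof (intro conjI allI ballI)
      show "0 \<in> ?N" using spin_rel_zero by blast
    qed (blast intro: spin_rel.add spin_rel.scale)+
    fix P u assume "u \<in> ?N"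
    then obtain m where u: "spin_rel I \<beta> u m" by blast
    show "act (e_loop P) u \<in> ?N" using spin_rel_e[OF u assms] by blast
    show "act (f_loop P) u \<in> ?N" using spin_rel.f[OF u] by blast
    show "act (h_loop P) u \<in> ?N" using spin_rel_h[OF u assms] by blast
  qed
  then have N: "?N = V" by (rule generated_eq) (use spin_rel.vac in blast)
  obtain B where B: "finite B" "B \<subseteq> V"
    "\<And>u m. spin_rel I \<beta> u m \<Longrightarrow> \<forall>S. m S \<noteq> 0 \<longrightarrow> S \<in> Pow I \<Longrightarrow> u \<in> span B"
    using finite_span_support[of "Pow I" I \<beta>] assms by auto
  have "V \<subseteq> span B"
  proof
    fix u assume "u \<in> V"
    then obtain m where u: "spin_rel I \<beta> u m" using N by blast
    then show "u \<in> span B" by (rule B(3)) (use spin_rel_support[OF u] in blast)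
  qed
  moreover have "span B \<subseteq> V" using B(2) V_subspace by (rule span_minimal)
  ultimately show ?thesis
    using B(1,2) by (auto simp: finite_dimensional_def)
qed

section \<open>Finite dimension forces a sum of evaluations\<close>

lemma finite_dimensional_relation:
  fixes u :: "nat \<Rightarrow> 'v"
  assumes "finite_dimensional scl V" and "\<And>k. u k \<in> V"
  obtains P :: "complex poly" where "P \<noteq> 0" "(\<Sum>k\<le>degree P. scl (coeff P k) (u k)) = 0"
proof -
  obtain B where B: "finite B" "span B = V"
    using assms(1) by (auto simp: finite_dimensional_def)
  obtain c :: "nat \<Rightarrow> complex" and K k where c: "(\<Sum>k\<le>K. scl (c k) (u k)) = 0" "k \<le> K" "c k \<noteq> 0"
  \<comment> \<open>Dependence concerns sets, while \<open>u\<close> may repeat. If the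
    \<open>card B + 1\<close> vectors are distinct, they outnumber a spanning set; if two agree,
    coefficients 1 and -1 give a relation.\<close>
  proof (cases "inj_on u {..card B}")
    case True
    have "dependent (u ` {..card B})"
    proof (rule ccontr)
      assume "independent (u ` {..card B})"
      then have "card (u ` {..card B}) \<le> card B"
        using independent_span_bound[OF B(1)] B(2) assms(2) by blast
      then show False using True by (simp add: card_image)
    qed
    then obtain d w where d: "(\<Sum>w\<in>u ` {..card B}. scl (d w) w) = 0" "w \<in> u ` {..card B}" "d w \<noteq> 0"
      by (auto simp: dependent_finite)
    then show ?thesis
      using that[of "\<lambda>k. d (u k)" "card B"] True by (auto simp: sum.reindex)
  next
    case False
    then obtain i j where ij: "i \<le> card B" "j \<le> card B" "i \<noteq> j" "u i = u j"
      by (auto simp: inj_on_def)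
    have "(\<Sum>k\<le>card B. scl (if k = i then 1 else if k = j then -1 else 0) (u k)) =
        (\<Sum>k\<in>{i, j}. scl (if k = i then 1 else if k = j then -1 else 0) (u k))"
      using ij by (intro sum.mono_neutral_right) auto
    also have "\<dots> = 0" using ij by simp
    finally show ?thesis
      using that[of "\<lambda>k. if k = i then 1 else if k = j then -1 else 0" "card B" i] ij(1) by simp
  qed
  define P where "P = (\<Sum>k\<le>K. monom (c k) k)"
  have coeff: "coeff P k = (if k \<le> K then c k else 0)" for k
    by (simp add: P_def coeff_sum)
  have "degree P \<le> K" by (rule degree_le) (simp add: coeff)
  then have "(\<Sum>k\<le>degree P. scl (coeff P k) (u k)) = (\<Sum>k\<le>K. scl (coeff P k) (u k))"
    by (intro sum.mono_neutral_left) (auto simp: coeff_eq_0)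
  also have "\<dots> = 0" using c(1) by (simp add: coeff cong: sum.cong_simp)
  finally have "(\<Sum>k\<le>degree P. scl (coeff P k) (u k)) = 0" .
  moreover have "P \<noteq> 0" using c(2,3) coeff[of k] by auto
  ultimately show ?thesis using that by blast
qed

text \<open>Applying \<open>h_loop A\<close> and \<open>e_loop A\<close> to the zero vector
  \<open>act (f_loop Q) v\<close> leaves only the commutator terms, both involving
  \<open>A * Q\<close>.\<close>

lemma act_f_mult_v_eq_0:
  assumes "act (f_loop Q) v = 0"
  shows "act (f_loop (A * Q)) v = 0" and "wt (A * Q) = 0"
proof -
  have "scl 2 (act (f_loop (A * Q)) v) = 0"
    using act_h_f[of v A Q] assms by (simp add: act_h_v act_scale act_zero)
  then show "act (f_loop (A * Q)) v = 0" by simp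
  have "scl (wt (A * Q)) v = 0"
    using act_e_f[of v A Q] assms by (simp add: act_h_v act_e_v act_zero)
  then show "wt (A * Q) = 0" using v_nonzero by simp
qed

definition f_string :: "complex poly \<Rightarrow> nat \<Rightarrow> 'v" where
  "f_string Q k = (act (f_loop Q) ^^ k) v"

lemma f_string_simps [simp]:
  "f_string Q 0 = v" "f_string Q (Suc k) = act (f_loop Q) (f_string Q k)"
  by (simp_all add: f_string_def)

lemma f_string_V [simp]: "f_string Q k \<in> V"
  by (induction k) simp_all

text \<open>
  For \<open>\<epsilon> = 1\<close> this is the usual computation in the copy of \<open>sl\<^sub>2\<close> given by an idempotent \<open>Q\<close>;
  for \<open>\<epsilon> = 0\<close> it is a Heisenberg algebra.
\<close>

lemma e_f_string:
  assumes "act (f_loop (Q * Q)) v = scl \<epsilon> (act (f_loop Q) v)"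
  shows "act (e_loop 1) (f_string Q (Suc k)) =
    scl (of_nat (Suc k) * (wt Q - \<epsilon> * of_nat k)) (f_string Q k)"
proof -
  \<comment> \<open>The hypothesis at \<open>v\<close> spreads along the string because the
    \<open>f_loop\<close> operators commute.\<close>
  have sq: "act (f_loop (Q * Q)) (f_string Q k) = scl \<epsilon> (f_string Q (Suc k))" for k
    by (induction k) (simp_all add: assms act_f_f[of _ "Q * Q" Q] act_scale)
  have h: "act (h_loop Q) (f_string Q k) = scl (wt Q - 2 * \<epsilon> * of_nat k) (f_string Q k)" for k
  proof (induction k)
    case (Suc k)
    then show ?case
      by (simp add: act_h_f sq act_scale flip: scale_left_diff_distrib) (simp add: algebra_simps)
  qed (simp add: act_h_v)
  show ?thesis
  proof (induction k)
    case 0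
    then show ?case by (simp add: act_e_f act_e_v act_zero act_h_v)
  next
    case (Suc k)
    have "act (e_loop 1) (f_string Q (Suc (Suc k))) =
        act (f_loop Q) (act (e_loop 1) (f_string Q (Suc k))) + act (h_loop Q) (f_string Q (Suc k))"
      using act_e_f[of "f_string Q (Suc k)" 1 Q] by simp
    also have "\<dots> = scl (of_nat (Suc k) * (wt Q - \<epsilon> * of_nat k)) (f_string Q (Suc k)) +
        scl (wt Q - 2 * \<epsilon> * of_nat (Suc k)) (f_string Q (Suc k))"
      unfolding Suc.IH h by (simp add: act_scale del: of_nat_Suc)
    also have "\<dots> = scl (of_nat (Suc (Suc k)) * (wt Q - \<epsilon> * of_nat (Suc k))) (f_string Q (Suc k))"
      by (simp add: algebra_simps flip: scale_left_distrib)
    finally show ?case .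
  qed
qed

text \<open>Otherwise no scalar in \<open>e_f_string\<close> vanishes, and \<open>e_loop 1\<close>
  steps down the string without loss, making all its vectors independent.\<close>

lemma wt_eq_multiple:
  assumes "finite_dimensional scl V"
    and Q: "act (f_loop (Q * Q)) v = scl \<epsilon> (act (f_loop Q) v)"
  shows "\<exists>k. wt Q = \<epsilon> * of_nat k"
proof (rule ccontr)
  assume *: "\<nexists>k. wt Q = \<epsilon> * of_nat k"
  have indep: "\<forall>k\<le>K. a k = 0" if "(\<Sum>k\<le>K. scl (a k) (f_string Q k)) = 0" for K and a :: "nat \<Rightarrow> complex"
    using that
  proof (induction K arbitrary: a)
    case 0
    then show ?case using v_nonzero by simp
  next
    case (Suc K)
    let ?e = "act (e_loop 1)"
    \<comment> \<open>The coefficients after applying \<open>e_loop 1\<close>: since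
      \<open>v\<close> is killed, the relation becomes one term shorter.\<close>
    define b where "b k = a (Suc k) * (of_nat (Suc k) * (wt Q - \<epsilon> * of_nat k))" for k
    have sum: "?e (\<Sum>k\<in>A. scl (a k) (f_string Q k)) = (\<Sum>k\<in>A. scl (a k) (?e (f_string Q k)))
        \<and> (\<Sum>k\<in>A. scl (a k) (f_string Q k)) \<in> V" if "finite A" for A
      using that by induction (simp_all add: act_add act_scale act_zero)
    have "0 = ?e (\<Sum>k\<le>Suc K. scl (a k) (f_string Q k))"
      using Suc.prems by (simp only:) (simp add: act_zero)
    also have "\<dots> = (\<Sum>k\<le>Suc K. scl (a k) (?e (f_string Q k)))"
      using sum by blast
    also have "\<dots> = (\<Sum>k\<le>K. scl (a (Suc k)) (?e (f_string Q (Suc k))))"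
      by (subst sum.atMost_Suc_shift) (simp add: act_e_v)
    also have "\<dots> = (\<Sum>k\<le>K. scl (b k) (f_string Q k))"
      unfolding e_f_string[OF Q] b_def by simp
    finally have "\<forall>k\<le>K. b k = 0" using Suc.IH[of b] by simp
    then have a: "a (Suc k) = 0" if "k \<le> K" for k
      using that * of_nat_neq_0[of k, where 'a = complex]
      by (auto simp: b_def simp del: of_nat_Suc)
    have "scl (a 0) v = 0"
      using Suc.prems by (subst (asm) sum.atMost_Suc_shift) (simp add: a)
    then have "a 0 = 0" using v_nonzero by simp
    show ?case
    proof (intro allI impI)
      show "a k = 0" if "k \<le> Suc K" for k
        using that a \<open>a 0 = 0\<close> by (cases k) auto
    qed
  qed
  obtain P :: "complex poly" where "P \<noteq> 0"
    "(\<Sum>k\<le>degree P. scl (coeff P k) (f_string Q k)) = 0"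
    using finite_dimensional_relation[OF assms(1), of "f_string Q"] by auto
  then show False using indep[of "coeff P" "degree P"] by auto
qed

text \<open>Each multiple \<open>A * Q\<close> also has its square in the annihilator, so the case
  \<open>\<epsilon> = 0\<close> gives \<open>wt (A * Q) = 0\<close> for every
  \<open>A\<close>.\<close>

lemma act_f_radical:
  assumes "finite_dimensional scl V" and "act (f_loop (Q * Q)) v = 0"
  shows "act (f_loop Q) v = 0"
proof (rule act_f_v_eq_0)
  fix A
  have "act (f_loop ((A * Q) * (A * Q))) v = 0"
    using act_f_mult_v_eq_0(1)[OF assms(2), of "A * A"] by (simp add: mult_ac)
  then show "wt (A * Q) = 0"
    using wt_eq_multiple[OF assms(1), of "A * Q" 0] by simp
qed

lemma act_f_power_radical:
  assumes "finite_dimensional scl V" and "act (f_loop (Q ^ n)) v = 0"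
  shows "act (f_loop Q) v = 0"
proof -
  \<comment> \<open>The exponent is raised to a power of two, so that repeated halving ends at
    \<open>Q\<close> itself.\<close>
  have "Q ^ 2 ^ n = Q ^ (2 ^ n - n) * Q ^ n"
    using less_exp[of n] by (simp flip: power_add)
  then have "act (f_loop (Q ^ 2 ^ n)) v = 0"
    using act_f_mult_v_eq_0(1)[OF assms(2), of "Q ^ (2 ^ n - n)"] by simp
  moreover have "act (f_loop (Q ^ 2 ^ j)) v = 0 \<Longrightarrow> act (f_loop Q) v = 0" for j
  proof (induction j)
    case (Suc j)
    have "Q ^ 2 ^ Suc j = Q ^ 2 ^ j * Q ^ 2 ^ j" by (simp add: mult_2 power_add)
    then have "act (f_loop (Q ^ 2 ^ j)) v = 0"
      using Suc.prems act_f_radical[OF assms(1), of "Q ^ 2 ^ j"] by simp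
    then show ?case by (rule Suc.IH)
  qed simp
  ultimately show ?thesis by blast
qed

lemma finite_roots_annihilator:
  assumes "finite_dimensional scl V"
  obtains B where "finite B" "act (f_loop (\<Prod>\<beta>\<in>B. [:-\<beta>, 1:])) v = 0"
proof -
  obtain P :: "complex poly" where P: "P \<noteq> 0"
    "(\<Sum>k\<le>degree P. scl (coeff P k) (act (f_loop (monom 1 k)) v)) = 0"
    using finite_dimensional_relation[OF assms, of "\<lambda>k. act (f_loop (monom 1 k)) v"] by auto
  have sum: "act (f_loop (\<Sum>k\<in>A. smult (c k) (M k))) v = (\<Sum>k\<in>A. scl (c k) (act (f_loop (M k)) v))"
    if "finite A" for A and c :: "nat \<Rightarrow> complex" and M
    using that by induction (simp_all add: act_f_add act_f_smult act_f_0)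
  have "P = (\<Sum>k\<le>degree P. smult (coeff P k) (monom 1 k))"
    by (simp add: smult_monom poly_as_sum_of_monoms)
  then have fP: "act (f_loop P) v = 0"
    using sum[of "{..degree P}" "coeff P" "monom 1"] P(2) by simp
  let ?B = "{x. poly P x = 0}"
  let ?R = "\<Prod>\<beta>\<in>?B. [:-\<beta>, 1:]"
  have fin: "finite ?B" using P(1) by (rule poly_roots_finite)
  \<comment> \<open>Multiplicities are at most the degree, so \<open>P\<close> divides a power of
    the product over its distinct roots, and the radical property applies.\<close>
  have "(\<Prod>\<beta>\<in>?B. [:-\<beta>, 1:] ^ order \<beta> P) dvd (\<Prod>\<beta>\<in>?B. [:-\<beta>, 1:] ^ degree P)"
    by (intro prod_dvd_prod le_imp_power_dvd order_degree P(1))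
  then have "smult (lead_coeff P) (\<Prod>\<beta>\<in>?B. [:-\<beta>, 1:] ^ order \<beta> P) dvd ?R ^ degree P"
    using P(1) by (simp only: prod_power_distrib) (rule smult_dvd; simp)
  then have "P dvd ?R ^ degree P"
    by (simp only: complex_poly_decompose)
  then obtain A where "?R ^ degree P = P * A" by (rule dvdE)
  then have "act (f_loop (?R ^ degree P)) v = 0"
    using act_f_mult_v_eq_0(1)[OF fP, of A] by (simp only: mult.commute)
  then show ?thesis
    using that[OF fin] act_f_power_radical[OF assms] by blast
qed

lemma wt_eq_evaluations:
  assumes fd: "finite_dimensional scl V"
  obtains B and n :: "complex \<Rightarrow> nat" where "finite B"
    "\<And>P. wt P = (\<Sum>\<beta>\<in>B. of_nat (n \<beta>) * poly P \<beta>)"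
proof -
  obtain B where B: "finite B" "act (f_loop (\<Prod>\<beta>\<in>B. [:-\<beta>, 1:])) v = 0"
    using finite_roots_annihilator[OF fd] .
  have vanish: "act (f_loop P) v = 0" "wt P = 0" if "\<And>\<beta>. \<beta> \<in> B \<Longrightarrow> poly P \<beta> = 0" for P
  proof -
    have "(\<Prod>\<beta>\<in>B. [:-\<beta>, 1:]) dvd P"
      using B(1) by (rule prod_linear_dvd) (rule that)
    then obtain A where "P = (\<Prod>\<beta>\<in>B. [:-\<beta>, 1:]) * A" by (rule dvdE)
    then show "act (f_loop P) v = 0" "wt P = 0"
      using act_f_mult_v_eq_0[OF B(2), of A] by (simp_all only: mult.commute)
  qed
  \<comment> \<open>The Lagrange polynomials for the nodes \<open>B\<close>, idempotent modulo
    polynomials vanishing on \<open>B\<close>.\<close>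
  define E where "E \<beta> = (\<Prod>\<gamma>\<in>B - {\<beta>}. smult (1 / (\<beta> - \<gamma>)) [:-\<gamma>, 1:])" for \<beta>
  have E: "poly (E \<beta>) \<gamma> = (if \<gamma> = \<beta> then 1 else 0)" if "\<gamma> \<in> B" "\<beta> \<in> B" for \<beta> \<gamma>
  proof (cases "\<gamma> = \<beta>")
    case True
    have "poly (E \<beta>) \<beta> = (\<Prod>\<gamma>\<in>B - {\<beta>}. (\<beta> - \<gamma>) / (\<beta> - \<gamma>))"
      by (simp add: E_def poly_prod diff_divide_distrib del: divide_self_if)
    also have "\<dots> = 1" by (intro prod.neutral) auto
    finally show ?thesis using True by simp
  next
    case False
    then show ?thesis using that B(1) by (auto simp: E_def poly_prod prod_zero_iff)
  qed
  have "\<exists>k::nat. wt (E \<beta>) = of_nat k" if "\<beta> \<in> B" for \<beta>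
  proof -
    have "act (f_loop (E \<beta> * E \<beta> + smult (-1) (E \<beta>))) v = 0"
      by (rule vanish) (use that in \<open>simp add: E\<close>)
    then have "act (f_loop (E \<beta> * E \<beta>)) v = scl 1 (act (f_loop (E \<beta>)) v)"
      unfolding act_f_add[OF v_V] act_f_smult[OF v_V] by simp
    then show ?thesis using wt_eq_multiple[OF fd] by fastforce
  qed
  then obtain n where n: "wt (E \<beta>) = of_nat (n \<beta>)" if "\<beta> \<in> B" for \<beta> by metis
  have "wt P = (\<Sum>\<beta>\<in>B. of_nat (n \<beta>) * poly P \<beta>)" for P
  proof -
    \<comment> \<open>Lagrange interpolation: \<open>?L\<close> agrees with \<open>P\<close> on
      \<open>B\<close>, so both have the same \<open>wt\<close>.\<close>
    let ?L = "\<Sum>\<beta>\<in>B. smult (poly P \<beta>) (E \<beta>)"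
    have "wt (P + smult (-1) ?L) = 0"
    proof (rule vanish)
      fix \<gamma> assume "\<gamma> \<in> B"
      then have "poly ?L \<gamma> = (\<Sum>\<beta>\<in>B. if \<gamma> = \<beta> then poly P \<beta> else 0)"
        by (simp add: poly_sum E if_distrib cong: sum.cong_simp if_cong)
      also have "\<dots> = poly P \<gamma>" using \<open>\<gamma> \<in> B\<close> B(1) by (simp add: sum.delta')
      finally show "poly (P + smult (-1) ?L) \<gamma> = 0" by simp
    qed
    then have "wt P = wt ?L" unfolding wt_add wt_smult by simp
    also have "\<dots> = (\<Sum>\<beta>\<in>B. of_nat (n \<beta>) * poly P \<beta>)"
      by (simp add: wt_sum n mult.commute cong: sum.cong_simp)
    finally show ?thesis .
  qed
  then show ?thesis using that B(1) by blast
qed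

lemma wt_poly_expansion:
  assumes "\<And>a. wt (monom 1 a) = (\<Sum>i\<in>I. \<beta> i ^ a)"
  shows "wt P = (\<Sum>i\<in>I. poly P (\<beta> i))"
proof -
  have "wt P = wt (\<Sum>k\<le>degree P. smult (coeff P k) (monom 1 k))"
    by (simp add: smult_monom poly_as_sum_of_monoms)
  also have "\<dots> = (\<Sum>k\<le>degree P. \<Sum>i\<in>I. coeff P k * \<beta> i ^ k)"
    by (simp add: wt_sum assms sum_distrib_left)
  also have "\<dots> = (\<Sum>i\<in>I. poly P (\<beta> i))"
    by (subst sum.swap) (simp add: poly_altdef)
  finally show ?thesis .
qed

end

section \<open>From multiplicities and evaluation points to the stated formula\<close>

lemma exists_add_inverse_eq:
  fixes \<beta> :: complex
  shows "\<exists>\<alpha>. \<alpha> \<noteq> 0 \<and> \<alpha> + inverse \<alpha> = \<beta>"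
proof -
  \<comment> \<open>The numbers \<open>(\<beta> + r) / 2\<close> and
    \<open>(\<beta> - r) / 2\<close> are the roots of \<open>x^2 - \<beta> x + 1\<close>, hence
    mutually inverse with sum \<open>\<beta>\<close>.\<close>
  define r where "r = csqrt (\<beta>\<^sup>2 - 4)"
  have r: "r\<^sup>2 = \<beta>\<^sup>2 - 4" by (simp add: r_def)
  have "(\<beta> + r) / 2 * ((\<beta> - r) / 2) = 1"
    using r by (simp add: field_simps power2_eq_square)
  then have "inverse ((\<beta> + r) / 2) = (\<beta> - r) / 2" "(\<beta> + r) / 2 \<noteq> 0"
    using inverse_unique by (blast, force)
  moreover have "(\<beta> + r) / 2 + (\<beta> - r) / 2 = \<beta>" by (simp add: field_simps)
  ultimately show ?thesis by metis
qed

lemma sum_multiplicities_eq_sum_list: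
  fixes g :: "'a \<Rightarrow> 'b \<Rightarrow> 'c::semiring_1"
  assumes "finite B"
  shows "\<exists>xs. \<forall>a. (\<Sum>x\<in>B. of_nat (n x) * g a x) = (\<Sum>x\<leftarrow>xs. g a x)"
  using assms
proof induction
  case (insert x B)
  then obtain xs where "\<forall>a. (\<Sum>x\<in>B. of_nat (n x) * g a x) = (\<Sum>x\<leftarrow>xs. g a x)" by blast
  then show ?case
    using insert.hyps
    by (intro exI[of _ "replicate (n x) x @ xs"]) (simp add: sum_list_replicate)
qed (auto intro: exI[of _ "[]"])

theorem theorem5p2p2:
  fixes \<phi> :: "loop \<Rightarrow> complex"
    and scl :: "complex \<Rightarrow> 'v::ab_group_add \<Rightarrow> 'v"
    and V :: "'v set"
    and act :: "loop \<Rightarrow> 'v \<Rightarrow> 'v"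
    and v :: 'v
  assumes "\<phi> \<in> Ltw_zero_dual"
    and "simple_highest_weight_module scl V act \<phi> v"
  shows "finite_dimensional scl V \<longleftrightarrow>
    (\<exists>(n::nat) (\<alpha>::nat \<Rightarrow> complex). (\<forall>i\<in>{1..n}. \<alpha> i \<noteq> 0) \<and>
       (\<forall>a::nat. \<phi> (w_tw a) = (\<Sum>i=1..n. (\<alpha> i + inverse (\<alpha> i)) ^ a)))"
proof
  interpret simple_highest_weight_module scl V act \<phi> v by (rule assms(2))
  assume "finite_dimensional scl V"
  then obtain B and n :: "complex \<Rightarrow> nat" where B: "finite B"
    "\<And>P. wt P = (\<Sum>\<beta>\<in>B. of_nat (n \<beta>) * poly P \<beta>)"
    using wt_eq_evaluations by blast
  obtain xs where "\<forall>a. (\<Sum>\<beta>\<in>B. of_nat (n \<beta>) * \<beta> ^ a) = (\<Sum>\<beta>\<leftarrow>xs. \<beta> ^ a)"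
    using sum_multiplicities_eq_sum_list[OF B(1), of n "\<lambda>a \<beta>. \<beta> ^ a"] by blast
  then have xs: "\<phi> (w_tw a) = (\<Sum>\<beta>\<leftarrow>xs. \<beta> ^ a)" for a
    using B(2)[of "monom 1 a"] by (simp add: w_tw_eq wt_def poly_monom)
  obtain r :: "complex \<Rightarrow> complex" where r: "\<And>\<beta>. r \<beta> \<noteq> 0" "\<And>\<beta>. r \<beta> + inverse (r \<beta>) = \<beta>"
    using exists_add_inverse_eq by metis
  have "\<phi> (w_tw a) = (\<Sum>i=1..length xs. (r (xs ! (i - 1)) + inverse (r (xs ! (i - 1)))) ^ a)" for a
  proof -
    have "\<phi> (w_tw a) = (\<Sum>i<length xs. (xs ! i) ^ a)"
      by (simp add: xs sum_list_sum_nth atLeast0LessThan)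
    \<comment> \<open>List positions start at 0 while the stated sum starts at 1.\<close>
    also have "\<dots> = (\<Sum>i=1..length xs. (xs ! (i - 1)) ^ a)"
      by (rule sum.reindex_bij_witness[of _ "\<lambda>i. i - 1" Suc]) auto
    finally show ?thesis by (simp add: r(2))
  qed
  then show "\<exists>(n::nat) (\<alpha>::nat \<Rightarrow> complex). (\<forall>i\<in>{1..n}. \<alpha> i \<noteq> 0) \<and>
       (\<forall>a::nat. \<phi> (w_tw a) = (\<Sum>i=1..n. (\<alpha> i + inverse (\<alpha> i)) ^ a))"
    using r(1) by (intro exI[of _ "length xs"] exI[of _ "\<lambda>i. r (xs ! (i - 1))"]) blast
next
  interpret simple_highest_weight_module scl V act \<phi> v by (rule assms(2))
  assume "\<exists>(n::nat) (\<alpha>::nat \<Rightarrow> complex). (\<forall>i\<in>{1..n}. \<alpha> i \<noteq> 0) \<and>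
       (\<forall>a::nat. \<phi> (w_tw a) = (\<Sum>i=1..n. (\<alpha> i + inverse (\<alpha> i)) ^ a))"
  then obtain n :: nat and \<alpha> where "\<forall>a. \<phi> (w_tw a) = (\<Sum>i=1..n. (\<alpha> i + inverse (\<alpha> i)) ^ a)"
    by blast
  then have "wt (monom 1 a) = (\<Sum>i=1..n. (\<alpha> i + inverse (\<alpha> i)) ^ a)" for a
    by (simp add: w_tw_eq wt_def)
  then have "wt P = (\<Sum>i=1..n. poly P (\<alpha> i + inverse (\<alpha> i)))" for P
    by (rule wt_poly_expansion)
  then show "finite_dimensional scl V"
    by (intro finite_dimensional_if_evaluations[of "{1..n}"]) auto
qed

end
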